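(* For each $n$ let $M(x)=M^{n\times n}(x)$ be an $n$-by-$n$ structured complex matrix (its entries being functions of a vector of complex parameters $x$) whose determinant $p_n(x)=\det M^{n\times n}(x)$ is a polynomial in $x$. Suppose that for any $n$, $p_n(x)$ has an irreducible factor $\hat p_n(x)$ whose degree goes to infinity as $n$ goes to infinity. Then for any enumerable set of black-box arithmetic operations of bounded degree, for sufficiently large $n$ it is impossible to accurately evaluate $p_n(x)$ over the complex numbers.
   Context: Black boxes. A black-box operation takes finitely many inputs $x_1,\dots,x_k$ and produces a polynomial $q(x_1,\dots,x_k)$. A set $\{q_j:j\in J\}$ of black-box operations has bounded degree if the degrees of the $q_j$ are bounded by a common constant. The set is always taken to include $x_1x_2$, $x_1+x_2$ and $x_1-x_2$. Extended arithmetic over $\mathbb{C}$. An algorithm using the set $\{q_j\}$ receives its input $x\in\mathbb{C}^N$ exactly and is a finite directed acyclic graph with input, computational, branching and output nodes. Each computational node applies some $q_j$ to its inputs $a_1,\dots,a_l$ (possibly with repetitions) and returns $q_j(a_1,\dots,a_l)(1+\delta_i)$, with $\delta_i\in\mathbb{C}$ a rounding error attached to that node; the $\delta_i$ of different nodes are independent variables. Negation is also available and is exact. The algorithm may or may not use comparisons and branching. It terminates in finitely many steps; its output is $p_{comp}(x,\delta)$, $\delta=(\delta_1,\dots,\delta_k)$, and $p_{comp}(x,0)=p(x)$, where $p$ is the polynomial being evaluated. It is accurate for $p$ on a domain $\mathcal{D}\subseteq\mathbb{C}^N$ if for every $0<\eta<1$ there is $0<\epsilon<1$ such that for all $x\in\mathcal{D}$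 and all $\delta$ with all $|\delta_i|\le\epsilon$, $|p_{comp}(x,\delta)-p(x)|\le\eta|p(x)|$. Accurate evaluation over the complex numbers means the existence of an accurate algorithm with $\mathcal{D}=\mathbb{C}^N$, where $N$ is the number of parameters. *)

theory Defs
  imports "HOL-Library.Poly_Mapping" "HOL-Library.Countable_Set" Jordan_Normal_Form.Determinant
begin

section \<open>Multivariate complex polynomials\<close>

text \<open>
  A polynomial maps finitely many monomials to nonzero coefficients, and a monomial maps finitely
  many variable indices to positive exponents. Units, divisibility and irreducibility are those of
  the resulting integral domain in countably many variables; factors of a nonzero polynomial
  involve only the variables of that polynomial, so nothing changes if one
  passes to the ring in finitely many variables.
\<close>

type_synonym mpoly = "(nat \<Rightarrow>\<^sub>0 nat) \<Rightarrow>\<^sub>0 complex"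

definition mvar :: "nat \<Rightarrow> mpoly" where
  "mvar i = Poly_Mapping.single (Poly_Mapping.single i 1) 1"

definition mpoly_vars :: "mpoly \<Rightarrow> nat set" where
  "mpoly_vars p = (\<Union>m\<in>Poly_Mapping.keys p. Poly_Mapping.keys m)"

definition mpoly_eval :: "(nat \<Rightarrow> complex) \<Rightarrow> mpoly \<Rightarrow> complex" where
  "mpoly_eval x p =
     (\<Sum>m\<in>Poly_Mapping.keys p. Poly_Mapping.lookup p m *
        (\<Prod>i\<in>Poly_Mapping.keys m. x i ^ Poly_Mapping.lookup m i))"

text \<open>The zero polynomial gets total degree 0.\<close>

definition total_degree :: "mpoly \<Rightarrow> nat" where
  "total_degree p =
     Max (insert 0 ((\<lambda>m. \<Sum>i\<in>Poly_Mapping.keys m. Poly_Mapping.lookup m i) `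
                      Poly_Mapping.keys p))"

section \<open>Algorithms in extended arithmetic\<close>

text \<open>
  A black-box operation is a polynomial, its inputs being the variables 0, 1, 2, ...
\<close>

definition black_boxes :: "mpoly set \<Rightarrow> bool" where
  "black_boxes B \<longleftrightarrow> {mvar 0 * mvar 1, mvar 0 + mvar 1, mvar 0 - mvar 1} \<subseteq> B"

definition bounded_degree :: "mpoly set \<Rightarrow> bool" where
  "bounded_degree B \<longleftrightarrow> (\<exists>D. \<forall>q\<in>B. total_degree q \<le> D)"

text \<open>
  An algorithm is a list of nodes; a node is named by its position in the list and execution starts
  at node 0. The last argument of an input, computational or negation node is the node executed
  next; a branching node \<open>Branch R a b v w\<close> compares the values of the nodes \<open>a\<close> and \<open>b\<close> by \<open>R\<close> and
  continues at \<open>v\<close> if the comparison succeeds and at \<open>w\<close> otherwise. All other node names are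
  references to previously computed values. Listing the nodes in a topological order loses no
  generality for a finite directed acyclic graph.
\<close>

datatype node =
    Input nat nat
  | Compute mpoly "nat list" nat
  | Negate nat nat
  | Branch "complex \<Rightarrow> complex \<Rightarrow> bool" nat nat nat nat
  | Output nat

type_synonym algorithm = "node list"

fun successors :: "node \<Rightarrow> nat set" where
  "successors (Input i w) = {w}"
| "successors (Compute q as w) = {w}"
| "successors (Negate a w) = {w}"
| "successors (Branch R a b v w) = {v, w}"
| "successors (Output a) = {}"

text \<open>
  \<open>B\<close> is the set of available operations, \<open>C\<close> the set of available comparisons
  (empty for algorithms without branching) and \<open>N\<close> the number of parameters.
\<close>

fun admissible_node ::
  "mpoly set \<Rightarrow> (complex \<Rightarrow> complex \<Rightarrow> bool) set \<Rightarrow> nat \<Rightarrow> node \<Rightarrow> bool" where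
  "admissible_node B C N (Input i w) \<longleftrightarrow> i < N"
| "admissible_node B C N (Compute q as w) \<longleftrightarrow> q \<in> B \<and> mpoly_vars q \<subseteq> {..<length as}"
| "admissible_node B C N (Branch R a b v w) \<longleftrightarrow> R \<in> C"
| "admissible_node B C N _ \<longleftrightarrow> True"

text \<open>
  \<open>runs G x \<delta> v env r\<close>: started at node \<open>v\<close>, with \<open>env\<close> holding the values of the nodes executed so
  far, the algorithm \<open>G\<close> outputs \<open>r\<close> on input \<open>x\<close>, where \<open>\<delta> v\<close> is the rounding error attached to
  node \<open>v\<close>. A run that refers to a node not executed before has no output.
\<close>

inductive runs ::
  "algorithm \<Rightarrow> complex vec \<Rightarrow> (nat \<Rightarrow> complex) \<Rightarrow> nat \<Rightarrow> (nat \<rightharpoonup> complex) \<Rightarrow> complex \<Rightarrow> bool"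
  for G x \<delta> where
  run_input: "\<lbrakk>v < length G; G ! v = Input i w; runs G x \<delta> w (env(v \<mapsto> x $ i)) r\<rbrakk>
    \<Longrightarrow> runs G x \<delta> v env r"
| run_compute: "\<lbrakk>v < length G; G ! v = Compute q as w; set as \<subseteq> dom env;
      runs G x \<delta> w (env(v \<mapsto> mpoly_eval (\<lambda>i. the (env (as ! i))) q * (1 + \<delta> v))) r\<rbrakk>
    \<Longrightarrow> runs G x \<delta> v env r"
| run_negate: "\<lbrakk>v < length G; G ! v = Negate a w; env a = Some y; runs G x \<delta> w (env(v \<mapsto> - y)) r\<rbrakk>
    \<Longrightarrow> runs G x \<delta> v env r"
| run_branch: "\<lbrakk>v < length G; G ! v = Branch R a b w w'; env a = Some y; env b = Some z;
      runs G x \<delta> (if R y z then w else w') env r\<rbrakk>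
    \<Longrightarrow> runs G x \<delta> v env r"
| run_output: "\<lbrakk>v < length G; G ! v = Output a; env a = Some r\<rbrakk> \<Longrightarrow> runs G x \<delta> v env r"

lemma runs_unique:
  assumes "runs G x \<delta> v env r" and "runs G x \<delta> v env s"
  shows "r = s"
  using assms
proof (induction arbitrary: s rule: runs.induct)
  case (run_input v i w env r)
  from run_input.prems run_input.hyps have "runs G x \<delta> w (env(v \<mapsto> x $ i)) s"
    by (cases rule: runs.cases) (simp_all del: fun_upd_apply)
  then show ?case by (rule run_input.IH)
next
  case (run_compute v q as w env r)
  from run_compute.prems run_compute.hyps have "runs G x \<delta> w (env(v \<mapsto> mpoly_eval (\<lambda>i. the (env (as ! i))) q * (1 + \<delta> v))) s"
    by (cases rule: runs.cases) (simp_all del: fun_upd_apply)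
  then show ?case by (rule run_compute.IH)
next
  case (run_negate v a w env y r)
  from run_negate.prems run_negate.hyps have "runs G x \<delta> w (env(v \<mapsto> - y)) s"
    by (cases rule: runs.cases) (simp_all del: fun_upd_apply)
  then show ?case by (rule run_negate.IH)
next
  case (run_branch v R a b w w' env y z r)
  from run_branch.prems run_branch.hyps have "runs G x \<delta> (if R y z then w else w') env s"
    by (cases rule: runs.cases) (simp_all del: fun_upd_apply split del: if_split)
  then show ?case by (rule run_branch.IH)
next
  case (run_output v a env r)
  from run_output.prems run_output.hyps show ?case
    by (cases rule: runs.cases) simp_all
qed

definition is_algorithm ::
  "mpoly set \<Rightarrow> (complex \<Rightarrow> complex \<Rightarrow> bool) set \<Rightarrow> nat \<Rightarrow> algorithm \<Rightarrow> bool" where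
  "is_algorithm B C N G \<longleftrightarrow>
     (\<forall>v<length G. admissible_node B C N (G ! v) \<and>
        (\<forall>w\<in>successors (G ! v). v < w \<and> w < length G)) \<and>
     (\<forall>x\<in>carrier_vec N. \<forall>\<delta>. \<exists>r. runs G x \<delta> 0 Map.empty r)"

definition p_comp :: "algorithm \<Rightarrow> complex vec \<Rightarrow> (nat \<Rightarrow> complex) \<Rightarrow> complex" where
  "p_comp G x \<delta> = (THE r. runs G x \<delta> 0 Map.empty r)"

definition algorithm_for ::
  "mpoly set \<Rightarrow> (complex \<Rightarrow> complex \<Rightarrow> bool) set \<Rightarrow> nat \<Rightarrow> mpoly \<Rightarrow> algorithm \<Rightarrow> bool" where
  "algorithm_for B C N p G \<longleftrightarrow>
     is_algorithm B C N G \<and>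
     (\<forall>x\<in>carrier_vec N. p_comp G x (\<lambda>_. 0) = mpoly_eval (($) x) p)"

definition accurate_on :: "complex vec set \<Rightarrow> mpoly \<Rightarrow> algorithm \<Rightarrow> bool" where
  "accurate_on D p G \<longleftrightarrow>
     (\<forall>\<eta>::real. 0 < \<eta> \<and> \<eta> < 1 \<longrightarrow>
       (\<exists>\<epsilon>::real. 0 < \<epsilon> \<and> \<epsilon> < 1 \<and>
         (\<forall>x\<in>D. \<forall>\<delta>. (\<forall>i<length G. cmod (\<delta> i) \<le> \<epsilon>) \<longrightarrow>
           cmod (p_comp G x \<delta> - mpoly_eval (($) x) p) \<le> \<eta> * cmod (mpoly_eval (($) x) p))))"

definition accurately_evaluable ::
  "mpoly set \<Rightarrow> (complex \<Rightarrow> complex \<Rightarrow> bool) set \<Rightarrow> nat \<Rightarrow> mpoly \<Rightarrow> bool" where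
  "accurately_evaluable B C N p \<longleftrightarrow>
     (\<exists>G. algorithm_for B C N p G \<and> accurate_on (carrier_vec N) p G)"

end

theory Submission
  imports Defs "HOL-Computational_Algebra.Fundamental_Theorem_Algebra"
begin

text \<open>
  An accurate algorithm must return exactly 0 at every zero of \<open>p\<close>, for all small rounding errors.
  That is a very strong demand on an algorithm whose rounding errors are independent, and it is
  violated as soon as an irreducible factor \<open>q\<close> of \<open>p\<close> has larger degree than every available
  operation.

  Fix one path through the algorithm. Along it every computed value is a polynomial in the inputs
  and the rounding errors, and the claim is that such a value is either identically 0 or not
  divisible by \<open>q\<close>. The value of a computational node is \<open>w (1 + \<delta>)\<close> with a fresh variable
  \<open>\<delta>\<close>, where \<open>w\<close> does not involve \<open>\<delta>\<close>. As long as \<open>q\<close> does not divide \<open>w\<close>, such values behave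
  modulo \<open>q\<close> like new independent variables: substituting them for variables cannot make a
  polynomial divisible by \<open>q\<close> that was not so before (\<open>generic_subst_extend\<close>). This step
  needs that \<open>q\<close> is prime, not only irreducible. Hence, when an operation is applied, divisibility
  of its result by \<open>q\<close> can be tested on a polynomial whose degree is at most that of the
  operation, and therefore smaller than that of \<open>q\<close>: the result vanishes identically or is not
  divisible by \<open>q\<close>. So a finite set of polynomials, one for each path, describes all outputs, and
  each of its nonzero members is not divisible by \<open>q\<close> (\<open>symbolic_results\<close>).

  By primality and a Nullstellensatz for hypersurfaces (\<open>hypersurface_nullstellensatz\<close>) there are
  a zero \<open>y\<close> of \<open>q\<close> and rounding errors, as small as desired, at which none of these nonzero
  polynomials vanishes. Keep these errors and let the input approach \<open>y\<close> along a line on which \<open>p\<close>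
  is not identically 0. Then \<open>p\<close> tends to 0 through nonzero values, while the output is either 0 or
  bounded away from 0, whichever path is taken; both contradict accuracy
  (\<open>not_accurately_evaluable\<close>). Comparing the outputs of nearby inputs in this way, instead of
  looking only at \<open>y\<close>, is what makes the argument immune to branching, even with comparisons that
  recognise the zeros of \<open>p\<close> exactly.

  Primality of irreducible polynomials in any number of variables comes from Gauss's
  argument, by induction on the set of variables (\<open>irreducible_imp_prime_elem_mpoly\<close>).
\<close>

section \<open>The universal property of polynomials\<close>

abbreviation monomial_value :: "(nat \<Rightarrow> 'a::comm_ring_1) \<Rightarrow> (nat \<Rightarrow>\<^sub>0 nat) \<Rightarrow> 'a" where
  "monomial_value s m \<equiv> (\<Prod>i\<in>Poly_Mapping.keys m. s i ^ Poly_Mapping.lookup m i)"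

definition mconst :: "complex \<Rightarrow> mpoly" where
  "mconst c = Poly_Mapping.single 0 c"

text \<open>
  The ring homomorphism that is \<open>h\<close> on coefficients and sends the \<open>i\<close>-th variable to \<open>s i\<close>.
  Evaluation, substitution, and reading a polynomial as a univariate one over the
  remaining variables are all instances, so identities between them reduce to identities on
  constants and variables.
\<close>
definition hom_ext :: "(complex \<Rightarrow> 'a::comm_ring_1) \<Rightarrow> (nat \<Rightarrow> 'a) \<Rightarrow> mpoly \<Rightarrow> 'a" where
  "hom_ext h s q =
     (\<Sum>m\<in>Poly_Mapping.keys q. h (Poly_Mapping.lookup q m) * monomial_value s m)"

lemma mpoly_eval_eq_hom_ext: "mpoly_eval x = hom_ext (\<lambda>c. c) x"
  by (simp add: mpoly_eval_def hom_ext_def fun_eq_iff)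

lemma monomial_value_superset:
  assumes "finite I" "Poly_Mapping.keys m \<subseteq> I"
  shows "monomial_value s m = (\<Prod>i\<in>I. s i ^ Poly_Mapping.lookup m i)"
  using assms by (intro prod.mono_neutral_left) (auto simp: in_keys_iff)

lemma monomial_value_add:
  "monomial_value s (m + n) = monomial_value s m * monomial_value s n"
proof -
  let ?I = "Poly_Mapping.keys m \<union> Poly_Mapping.keys n"
  have "monomial_value s (m + n) = (\<Prod>i\<in>?I. s i ^ Poly_Mapping.lookup (m + n) i)"
    by (rule monomial_value_superset) (use Poly_Mapping.keys_add[of m n] in auto)
  also have "\<dots> = (\<Prod>i\<in>?I. s i ^ Poly_Mapping.lookup m i) * (\<Prod>i\<in>?I. s i ^ Poly_Mapping.lookup n i)"
    by (simp add: lookup_add power_add prod.distrib)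
  also have "(\<Prod>i\<in>?I. s i ^ Poly_Mapping.lookup m i) = monomial_value s m"
    by (rule monomial_value_superset[symmetric]) auto
  also have "(\<Prod>i\<in>?I. s i ^ Poly_Mapping.lookup n i) = monomial_value s n"
    by (rule monomial_value_superset[symmetric]) auto
  finally show ?thesis .
qed

lemma mpoly_sum_single: "(\<Sum>m\<in>Poly_Mapping.keys f. Poly_Mapping.single m (Poly_Mapping.lookup f m)) = f"
proof (rule poly_mapping_eqI)
  fix k
  show "Poly_Mapping.lookup (\<Sum>m\<in>Poly_Mapping.keys f. Poly_Mapping.single m (Poly_Mapping.lookup f m)) k
      = Poly_Mapping.lookup f k"
    by (cases "k \<in> Poly_Mapping.keys f")
       (auto simp: lookup_sum lookup_single when_def in_keys_iff sum.delta')
qed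

lemma hom_ext_superset:
  assumes "h 0 = 0" "finite K" "Poly_Mapping.keys q \<subseteq> K"
  shows "hom_ext h s q = (\<Sum>m\<in>K. h (Poly_Mapping.lookup q m) * monomial_value s m)"
  unfolding hom_ext_def using assms
  by (intro sum.mono_neutral_left) (auto simp: in_keys_iff)

context
  fixes h :: "complex \<Rightarrow> 'a::comm_ring_1"
  assumes h: "comm_ring_hom h"
begin

interpretation h: comm_ring_hom h by (rule h)

lemma hom_ext_zero: "hom_ext h s 0 = 0"
  by (simp add: hom_ext_def)

lemma hom_ext_single: "hom_ext h s (Poly_Mapping.single m c) = h c * monomial_value s m"
  by (cases "c = 0") (auto simp: hom_ext_def)

lemma hom_ext_add: "hom_ext h s (f + g) = hom_ext h s f + hom_ext h s g"
proof -
  let ?K = "Poly_Mapping.keys f \<union> Poly_Mapping.keys g"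
  have "hom_ext h s q = (\<Sum>m\<in>?K. h (Poly_Mapping.lookup q m) * monomial_value s m)"
    if "Poly_Mapping.keys q \<subseteq> ?K" for q
    using that by (intro hom_ext_superset) auto
  from this[of f] this[of g] this[of "f + g"] show ?thesis
    using Poly_Mapping.keys_add[of f g]
    by (simp add: lookup_add h.hom_add distrib_right sum.distrib)
qed

lemma hom_ext_sum: "hom_ext h s (sum F I) = (\<Sum>i\<in>I. hom_ext h s (F i))"
  by (induction I rule: infinite_finite_induct) (simp_all add: hom_ext_zero hom_ext_add)

lemma hom_ext_mult: "hom_ext h s (f * g) = hom_ext h s f * hom_ext h s g"
proof -
  have "f * g = (\<Sum>m\<in>Poly_Mapping.keys f. \<Sum>n\<in>Poly_Mapping.keys g.
      Poly_Mapping.single (m + n) (Poly_Mapping.lookup f m * Poly_Mapping.lookup g n))"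
    by (subst mpoly_sum_single[of f, symmetric], subst mpoly_sum_single[of g, symmetric])
       (simp add: sum_product mult_single)
  also have "hom_ext h s \<dots> = hom_ext h s f * hom_ext h s g"
    by (simp add: hom_ext_sum hom_ext_single hom_ext_def[of h s f] hom_ext_def[of h s g]
        monomial_value_add h.hom_mult sum_product mult_ac)
  finally show ?thesis .
qed

lemma comm_ring_hom_hom_ext: "comm_ring_hom (hom_ext h s)"
proof
  show "hom_ext h s 1 = 1"
    using hom_ext_single[of s 0 1] by simp
qed (simp_all add: hom_ext_zero hom_ext_add hom_ext_mult)

lemma hom_ext_mconst: "hom_ext h s (mconst c) = h c"
  by (simp add: mconst_def hom_ext_single)

lemma hom_ext_mvar: "hom_ext h s (mvar i) = s i"
  by (simp add: mvar_def hom_ext_single)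

end

lemma comm_ring_hom_ident: "comm_ring_hom (\<lambda>x::'a::comm_ring_1. x)"
  by standard auto

lemma comm_ring_hom_const_poly: "comm_ring_hom (\<lambda>c::'a::comm_ring_1. [:c:])"
  by standard auto

lemma comm_ring_hom_comp:
  "comm_ring_hom f \<Longrightarrow> comm_ring_hom g \<Longrightarrow> comm_ring_hom (\<lambda>x. f (g x))"
proof -
  assume "comm_ring_hom f" "comm_ring_hom g"
  then interpret f: comm_ring_hom f + g: comm_ring_hom g by simp_all
  show ?thesis
    by standard (simp_all add: f.hom_add g.hom_add f.hom_mult g.hom_mult)
qed

lemma comm_ring_hom_mconst: "comm_ring_hom mconst"
  by standard (auto simp: mconst_def single_add mult_single)

lemma hom_hom_ext:
  assumes "comm_ring_hom H"
  shows "H (hom_ext h s f) = hom_ext (\<lambda>c. H (h c)) (\<lambda>i. H (s i)) f"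
proof -
  interpret comm_ring_hom H by fact
  show ?thesis by (simp add: hom_ext_def hom_distribs)
qed

lemma mvar_power: "mvar i ^ n = Poly_Mapping.single (Poly_Mapping.single i n) 1"
  by (induction n) (simp_all add: mvar_def mult_single flip: single_add)

lemma monomial_value_mvar: "monomial_value mvar m = Poly_Mapping.single m 1"
proof -
  have *: "(\<Prod>i\<in>I. Poly_Mapping.single (F i) (1::complex)) = Poly_Mapping.single (\<Sum>i\<in>I. F i) 1"
    for F :: "nat \<Rightarrow> (nat \<Rightarrow>\<^sub>0 nat)" and I
    by (induction I rule: infinite_finite_induct) (simp_all add: mult_single)
  have "(\<Sum>i\<in>Poly_Mapping.keys m. Poly_Mapping.single i (Poly_Mapping.lookup m i)) = m"
    by (rule poly_mapping_eqI) (auto simp: lookup_sum lookup_single when_def in_keys_iff sum.delta')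
  then show ?thesis by (simp add: mvar_power *)
qed

lemma hom_ext_mconst_mvar: "hom_ext mconst mvar f = f"
  by (simp add: hom_ext_def monomial_value_mvar mconst_def mult_single mpoly_sum_single)

text \<open>
  Two homomorphisms are compared by bringing both into this form, which depends only on their
  values on constants and variables.
\<close>
lemma hom_eq_hom_ext:
  assumes "comm_ring_hom H"
  shows "H f = hom_ext (\<lambda>c. H (mconst c)) (\<lambda>i. H (mvar i)) f"
  using hom_hom_ext[OF assms, of mconst mvar f] by (simp add: hom_ext_mconst_mvar)

lemma hom_ext_cong:
  assumes "\<And>c. h c = h' c" "\<And>i. i \<in> mpoly_vars f \<Longrightarrow> s i = s' i"
  shows "hom_ext h s f = hom_ext h' s' f"
proof -
  have "s i = s' i" if "m \<in> Poly_Mapping.keys f" "i \<in> Poly_Mapping.keys m" for m i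
    using that assms(2)[of i] by (auto simp: mpoly_vars_def)
  then show ?thesis
    unfolding hom_ext_def using assms(1)
    by (intro sum.cong arg_cong2[of _ _ _ _ "(*)"] prod.cong) auto
qed

section \<open>Variables and degrees\<close>

lemma finite_mpoly_vars: "finite (mpoly_vars f)"
  by (simp add: mpoly_vars_def)

lemma mpoly_vars_mconst: "mpoly_vars (mconst c) = {}"
  by (simp add: mpoly_vars_def mconst_def)

lemma mpoly_vars_zero_one: "mpoly_vars 0 = {}" "mpoly_vars 1 = {}"
  by (simp_all add: mpoly_vars_def)

lemma mpoly_vars_mvar: "mpoly_vars (mvar i) = {i}"
  by (simp add: mpoly_vars_def mvar_def)

lemma mpoly_vars_add: "mpoly_vars (f + g) \<subseteq> mpoly_vars f \<union> mpoly_vars g"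
  using Poly_Mapping.keys_add[of f g] by (auto simp: mpoly_vars_def)

lemma mpoly_vars_mult: "mpoly_vars (f * g) \<subseteq> mpoly_vars f \<union> mpoly_vars g"
proof
  fix i assume "i \<in> mpoly_vars (f * g)"
  then obtain m where m: "m \<in> Poly_Mapping.keys (f * g)" "i \<in> Poly_Mapping.keys m"
    by (auto simp: mpoly_vars_def)
  then obtain a b where "m = a + b" "a \<in> Poly_Mapping.keys f" "b \<in> Poly_Mapping.keys g"
    using keys_mult[of f g] by auto
  then show "i \<in> mpoly_vars f \<union> mpoly_vars g"
    using m(2) Poly_Mapping.keys_add[of a b] by (auto simp: mpoly_vars_def)
qed

lemma mpoly_vars_uminus: "mpoly_vars (- f) = mpoly_vars f"
  by (simp add: mpoly_vars_def in_keys_iff)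

lemma mpoly_vars_diff: "mpoly_vars (f - g) \<subseteq> mpoly_vars f \<union> mpoly_vars g"
  using mpoly_vars_add[of f "- g"] by (simp add: mpoly_vars_uminus)

lemma mpoly_vars_sum: "(\<And>i. i \<in> I \<Longrightarrow> mpoly_vars (F i) \<subseteq> V) \<Longrightarrow> mpoly_vars (sum F I) \<subseteq> V"
proof (induction I rule: infinite_finite_induct)
  case (insert i I)
  then show ?case using mpoly_vars_add[of "F i" "sum F I"] by auto
qed (simp_all add: mpoly_vars_zero_one)

lemma mpoly_vars_power: "mpoly_vars (f ^ n) \<subseteq> mpoly_vars f"
proof (induction n)
  case (Suc n)
  then show ?case using mpoly_vars_mult[of f "f ^ n"] by auto
qed (simp add: mpoly_vars_zero_one)

text \<open>
  A bound on the variables of a polynomial, or of the coefficients of a univariate polynomial,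
  describes a subring; it therefore suffices to check such bounds on the images of constants and
  variables.
\<close>
lemma hom_ext_closed:
  assumes add: "\<And>a b. a \<in> A \<Longrightarrow> b \<in> A \<Longrightarrow> a + b \<in> A"
    and mult: "\<And>a b. a \<in> A \<Longrightarrow> b \<in> A \<Longrightarrow> a * b \<in> A"
    and zero_one: "0 \<in> A" "1 \<in> A"
    and h: "\<And>c. h c \<in> A" and s: "\<And>i. i \<in> mpoly_vars f \<Longrightarrow> s i \<in> A"
  shows "hom_ext h s f \<in> A"
proof -
  have sum: "sum F I \<in> A" if "\<And>i. i \<in> I \<Longrightarrow> F i \<in> A" for F :: "(nat \<Rightarrow>\<^sub>0 nat) \<Rightarrow> 'a" and I
    using that by (induction I rule: infinite_finite_induct) (auto intro: add zero_one)
  have prod: "prod F I \<in> A" if "\<And>i. i \<in> I \<Longrightarrow> F i \<in> A" for F :: "nat \<Rightarrow> 'a" and I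
    using that by (induction I rule: infinite_finite_induct) (auto intro: mult zero_one)
  have power: "a ^ n \<in> A" if "a \<in> A" for a n
    using that by (induction n) (auto intro: mult zero_one)
  show ?thesis
    unfolding hom_ext_def
    by (intro sum mult h prod power s) (auto simp: mpoly_vars_def)
qed

lemma mpoly_vars_subst:
  assumes "\<And>i. i \<in> mpoly_vars f \<Longrightarrow> mpoly_vars (s i) \<subseteq> V"
  shows "mpoly_vars (hom_ext mconst s f) \<subseteq> V"
proof -
  have "hom_ext mconst s f \<in> {g. mpoly_vars g \<subseteq> V}"
  proof (rule hom_ext_closed)
    fix a b assume ab: "a \<in> {g. mpoly_vars g \<subseteq> V}" "b \<in> {g. mpoly_vars g \<subseteq> V}"
    show "a + b \<in> {g. mpoly_vars g \<subseteq> V}"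
      using ab mpoly_vars_add[of a b] by blast
    show "a * b \<in> {g. mpoly_vars g \<subseteq> V}"
      using ab mpoly_vars_mult[of a b] by blast
  qed (use assms in \<open>simp_all add: mpoly_vars_zero_one mpoly_vars_mconst\<close>)
  then show ?thesis by simp
qed

text \<open>
  A polynomial as a univariate polynomial in the variable \<open>y\<close>, whose coefficients are polynomials
  in the other variables.
\<close>
definition as_poly :: "nat \<Rightarrow> mpoly \<Rightarrow> mpoly poly" where
  "as_poly y = hom_ext (\<lambda>c. [:mconst c:]) (\<lambda>i. if i = y then [:0, 1:] else [:mvar i:])"

lemma comm_ring_hom_const_mconst: "comm_ring_hom (\<lambda>c. [:mconst c:])"
  by (rule comm_ring_hom_comp[OF comm_ring_hom_const_poly comm_ring_hom_mconst])

lemma comm_ring_hom_as_poly: "comm_ring_hom (as_poly y)"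
  unfolding as_poly_def by (rule comm_ring_hom_hom_ext[OF comm_ring_hom_const_mconst])

interpretation as_poly: comm_ring_hom "as_poly y" for y
  by (rule comm_ring_hom_as_poly)

lemma comm_ring_hom_poly: "comm_ring_hom (\<lambda>P. poly P (a::'a::comm_ring_1))"
  by standard auto

lemma poly_as_poly: "poly (as_poly y f) (mvar y) = f"
proof -
  have "poly (as_poly y f) (mvar y) = hom_ext mconst mvar f"
    unfolding as_poly_def hom_hom_ext[OF comm_ring_hom_poly]
    by (rule hom_ext_cong) auto
  then show ?thesis by (simp add: hom_ext_mconst_mvar)
qed

lemma as_poly_eq_0_iff: "as_poly y f = 0 \<longleftrightarrow> f = 0"
  using poly_as_poly[of y f] by auto

lemma as_poly_const:
  assumes "y \<notin> mpoly_vars f"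
  shows "as_poly y f = [:f:]"
  unfolding hom_eq_hom_ext[OF comm_ring_hom_const_poly, of f] as_poly_def
  using assms by (intro hom_ext_cong) auto

lemma as_poly_mvar: "as_poly y (mvar y) = [:0, 1:]"
  by (simp add: as_poly_def hom_ext_mvar[OF comm_ring_hom_const_mconst])

lemma mpoly_vars_coeff_as_poly:
  "mpoly_vars (coeff (as_poly y f) k) \<subseteq> mpoly_vars f - {y}"
proof -
  define V where "V = mpoly_vars f - {y}"
  have "as_poly y f \<in> {P. \<forall>k. mpoly_vars (coeff P k) \<subseteq> V}"
    unfolding as_poly_def
  proof (rule hom_ext_closed)
    fix P Q :: "mpoly poly"
    assume P: "P \<in> {P. \<forall>k. mpoly_vars (coeff P k) \<subseteq> V}"
      and Q: "Q \<in> {P. \<forall>k. mpoly_vars (coeff P k) \<subseteq> V}"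
    have "mpoly_vars (coeff P k + coeff Q k) \<subseteq> V" for k
      using P Q mpoly_vars_add[of "coeff P k" "coeff Q k"] by blast
    then show "P + Q \<in> {P. \<forall>k. mpoly_vars (coeff P k) \<subseteq> V}"
      by simp
    have "mpoly_vars (coeff P i * coeff Q j) \<subseteq> V" for i j
      using P Q mpoly_vars_mult[of "coeff P i" "coeff Q j"] by blast
    then have "mpoly_vars (coeff (P * Q) k) \<subseteq> V" for k
      unfolding coeff_mult by (intro mpoly_vars_sum)
    then show "P * Q \<in> {P. \<forall>k. mpoly_vars (coeff P k) \<subseteq> V}"
      by blast
  qed (auto simp: V_def coeff_pCons mpoly_vars_zero_one mpoly_vars_mconst mpoly_vars_mvar
        split: nat.splits)
  then show ?thesis by (auto simp: V_def)
qed

lemma degree_as_poly_eq_0_iff: "degree (as_poly y f) = 0 \<longleftrightarrow> y \<notin> mpoly_vars f"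
proof
  assume "degree (as_poly y f) = 0"
  then have eq: "as_poly y f = [:coeff (as_poly y f) 0:]"
    by (metis degree_0_id)
  have "f = coeff (as_poly y f) 0"
    using poly_as_poly[of y f] by (subst (asm) eq) simp
  then show "y \<notin> mpoly_vars f"
    using mpoly_vars_coeff_as_poly[of y f 0] by auto
qed (simp add: as_poly_const)

text \<open>
  The degree in \<open>y\<close> adds up in products because the coefficients form an integral domain, so a
  variable of a factor cannot cancel.
\<close>
lemma mpoly_vars_mult_left:
  assumes "f * g \<noteq> 0"
  shows "mpoly_vars f \<subseteq> mpoly_vars (f * g)"
proof
  fix y assume "y \<in> mpoly_vars f"
  moreover have "degree (as_poly y (f * g)) = degree (as_poly y f) + degree (as_poly y g)"
    using assms by (simp add: as_poly.hom_mult degree_mult_eq as_poly_eq_0_iff)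
  ultimately show "y \<in> mpoly_vars (f * g)"
    using degree_as_poly_eq_0_iff by (metis add_is_0)
qed

lemma mpoly_vars_dvd: "f dvd g \<Longrightarrow> g \<noteq> 0 \<Longrightarrow> mpoly_vars f \<subseteq> mpoly_vars g"
  by (auto elim!: dvdE intro: mpoly_vars_mult_left[THEN subsetD])

lemma mpoly_vars_unit: "f dvd 1 \<Longrightarrow> mpoly_vars f = {}"
  using mpoly_vars_dvd[of f 1] by (simp add: mpoly_vars_zero_one)

lemma mpoly_eq_mconst_if_vars_empty:
  assumes "mpoly_vars f = {}"
  shows "f = mconst (Poly_Mapping.lookup f 0)"
proof -
  have "Poly_Mapping.keys f \<subseteq> {0}"
    using assms by (auto simp: mpoly_vars_def)
  then show ?thesis
    by (subst (1) mpoly_sum_single[symmetric])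
       (auto simp: mconst_def subset_singleton_iff in_keys_iff)
qed

lemma mpoly_unit_if_vars_empty:
  assumes "mpoly_vars f = {}" "f \<noteq> 0"
  shows "f dvd 1"
proof -
  obtain c where c: "f = mconst c" using mpoly_eq_mconst_if_vars_empty[OF assms(1)] by blast
  with assms(2) have "c \<noteq> 0" by (auto simp: mconst_def)
  then have "f * mconst (inverse c) = 1"
    by (simp add: c mconst_def mult_single)
  then show ?thesis by (metis dvd_triv_left)
qed

section \<open>Total degree\<close>

text \<open>
  Multiplying each variable by a new variable \<open>X\<close> turns the total degree into the degree in \<open>X\<close>,
  for which the additivity and the estimates for univariate polynomials are available.
\<close>
definition homogenize :: "mpoly \<Rightarrow> mpoly poly" where
  "homogenize = hom_ext (\<lambda>c. [:mconst c:]) (\<lambda>i. [:0, mvar i:])"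

interpretation homogenize: comm_ring_hom homogenize
  unfolding homogenize_def by (rule comm_ring_hom_hom_ext[OF comm_ring_hom_const_mconst])

abbreviation monomial_degree :: "(nat \<Rightarrow>\<^sub>0 nat) \<Rightarrow> nat" where
  "monomial_degree m \<equiv> (\<Sum>i\<in>Poly_Mapping.keys m. Poly_Mapping.lookup m i)"

lemma homogenize_monom:
  "homogenize f = (\<Sum>m\<in>Poly_Mapping.keys f.
     monom (Poly_Mapping.single m (Poly_Mapping.lookup f m)) (monomial_degree m))"
proof -
  have prod_monom: "(\<Prod>i\<in>I. monom (F i) (n i)) = monom (\<Prod>i\<in>I. F i) (\<Sum>i\<in>I. n i)"
    if "finite I" for F :: "nat \<Rightarrow> mpoly" and n I
    using that by (induction I rule: finite_induct) (simp_all add: mult_monom monom_0)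
  have X: "[:0, x:] = monom x 1" for x :: mpoly
    by (simp add: monom_Suc monom_0)
  have "monomial_value (\<lambda>i. [:0, mvar i:]) m = monom (monomial_value mvar m) (monomial_degree m)"
    for m unfolding X by (simp add: monom_power prod_monom)
  then show ?thesis
    by (simp add: homogenize_def hom_ext_def monomial_value_mvar smult_monom mconst_def mult_single)
qed

lemma degree_homogenize: "degree (homogenize f) = total_degree f"
proof (rule antisym)
  show "degree (homogenize f) \<le> total_degree f"
    unfolding homogenize_monom
  proof (rule degree_sum_le)
    fix m assume "m \<in> Poly_Mapping.keys f"
    then have "monomial_degree m \<le> total_degree f"
      by (auto simp: total_degree_def intro!: Max_ge)
    then show "degree (monom (Poly_Mapping.single m (Poly_Mapping.lookup f m)) (monomial_degree m)) \<le> total_degree f"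
      using degree_monom_le order_trans by blast
  qed simp
  show "total_degree f \<le> degree (homogenize f)"
  proof (cases "f = 0")
    case False
    have "total_degree f \<in> insert 0 (monomial_degree ` Poly_Mapping.keys f)"
      unfolding total_degree_def by (rule Max_in) auto
    moreover have "monomial_degree m \<le> degree (homogenize f)" if m: "m \<in> Poly_Mapping.keys f" for m
    proof (rule le_degree)
      have "Poly_Mapping.lookup (coeff (homogenize f) (monomial_degree m)) m
          = (\<Sum>n\<in>Poly_Mapping.keys f. if n = m then Poly_Mapping.lookup f n else 0)"
        unfolding homogenize_monom coeff_sum lookup_sum
        by (rule sum.cong) (auto simp: lookup_single when_def)
      also have "\<dots> = Poly_Mapping.lookup f m"
        using m by simp
      finally show "coeff (homogenize f) (monomial_degree m) \<noteq> 0"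
        using m by (auto simp: in_keys_iff)
    qed
    ultimately show ?thesis by auto
  qed (simp add: total_degree_def)
qed

lemma homogenize_eq_0_iff: "homogenize f = 0 \<longleftrightarrow> f = 0"
proof
  assume *: "homogenize f = 0"
  have "f = hom_ext mconst mvar f" by (simp add: hom_ext_mconst_mvar)
  also have "\<dots> = poly (homogenize f) 1"
    unfolding homogenize_def hom_hom_ext[OF comm_ring_hom_poly] by simp
  finally show "f = 0" by (simp add: *)
qed simp

lemma total_degree_mult:
  "f \<noteq> 0 \<Longrightarrow> g \<noteq> 0 \<Longrightarrow> total_degree (f * g) = total_degree f + total_degree g"
  by (simp flip: degree_homogenize add: homogenize.hom_mult degree_mult_eq homogenize_eq_0_iff)

lemma total_degree_subst_le:
  assumes "\<And>i. total_degree (s i) \<le> 1"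
  shows "total_degree (hom_ext mconst s f) \<le> total_degree f"
proof -
  have const: "degree (homogenize (mconst c)) = 0" for c
    by (simp add: homogenize_def hom_ext_mconst[OF comm_ring_hom_const_mconst])
  have "degree (homogenize (hom_ext mconst s f)) \<le> total_degree f"
    unfolding hom_hom_ext[OF homogenize.comm_ring_hom_axioms]
    unfolding hom_ext_def
  proof (rule degree_sum_le)
    fix m assume m: "m \<in> Poly_Mapping.keys f"
    have "degree (homogenize (s i) ^ n) \<le> n" for i n
    proof -
      have "degree (homogenize (s i) ^ n) \<le> degree (homogenize (s i)) * n"
        by (rule degree_power_le)
      also have "\<dots> \<le> 1 * n"
        using assms[of i] by (intro mult_right_mono) (auto simp: degree_homogenize)
      finally show ?thesis by simp
    qed
    then have "degree (monomial_value (\<lambda>i. homogenize (s i)) m) \<le> monomial_degree m"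
      by (intro degree_prod_sum_le[THEN order_trans]) (auto intro!: sum_mono)
    moreover have "monomial_degree m \<le> total_degree f"
      using m by (auto simp: total_degree_def intro!: Max_ge)
    ultimately show "degree (homogenize (mconst (Poly_Mapping.lookup f m)) *
        monomial_value (\<lambda>i. homogenize (s i)) m) \<le> total_degree f"
      using degree_mult_le[of "homogenize (mconst (Poly_Mapping.lookup f m))" "monomial_value (\<lambda>i. homogenize (s i)) m"]
      by (simp add: const)
  qed simp
  then show ?thesis by (simp add: degree_homogenize)
qed

lemma total_degree_eq_0:
  assumes "total_degree f = 0"
  shows "mpoly_vars f = {}"
proof -
  have "monomial_degree m = 0" if "m \<in> Poly_Mapping.keys f" for m
    using that assms Max_ge[of "insert 0 (monomial_degree ` Poly_Mapping.keys f)" "monomial_degree m"]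
    by (simp add: total_degree_def)
  then show ?thesis by (fastforce simp: mpoly_vars_def in_keys_iff)
qed

lemma irreducible_factor_exists:
  fixes f :: mpoly
  assumes "f \<noteq> 0" "\<not> f dvd 1"
  shows "\<exists>g. irreducible g \<and> g dvd f"
  using assms
proof (induction "total_degree f" arbitrary: f rule: less_induct)
  case less
  show ?case
  proof (cases "irreducible f")
    case False
    then obtain a b where ab: "f = a * b" "\<not> a dvd 1" "\<not> b dvd 1"
      using less.prems by (auto simp: irreducible_def)
    then have "a \<noteq> 0" "b \<noteq> 0" using less.prems by auto
    then have "total_degree a < total_degree f"
      using ab total_degree_mult[of a b] total_degree_eq_0[of b] mpoly_unit_if_vars_empty[of b]
      by auto
    then obtain g where "irreducible g" "g dvd a"
      using less.hyps ab \<open>a \<noteq> 0\<close> by blast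
    then show ?thesis using ab by auto
  qed auto
qed

section \<open>Irreducible polynomials are prime\<close>

text \<open>
  Gauss's argument: if neither factor is divisible by \<open>c\<close>, look at the first coefficient of each
  that is not; their product is, up to multiples of \<open>c\<close>, a coefficient of the product. Only the
  coefficients at hand are required to respect primality of \<open>c\<close>, so that the lemma applies
  when \<open>c\<close> is known to be prime in a subring.
\<close>
lemma gauss_content:
  fixes c :: "'a::comm_ring_1"
  assumes c: "\<And>i j. c dvd coeff P i * coeff Q j \<Longrightarrow> c dvd coeff P i \<or> c dvd coeff Q j"
    and PQ: "\<And>k. c dvd coeff (P * Q) k"
  shows "(\<forall>i. c dvd coeff P i) \<or> (\<forall>j. c dvd coeff Q j)"
proof (rule ccontr)
  assume neg: "\<not> ?thesis"
  define i where "i = (LEAST i. \<not> c dvd coeff P i)"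
  define j where "j = (LEAST j. \<not> c dvd coeff Q j)"
  from neg have ex: "\<exists>i. \<not> c dvd coeff P i" "\<exists>j. \<not> c dvd coeff Q j" by blast+
  have i: "\<not> c dvd coeff P i" unfolding i_def by (rule LeastI_ex[OF ex(1)])
  have j: "\<not> c dvd coeff Q j" unfolding j_def by (rule LeastI_ex[OF ex(2)])
  have i': "c dvd coeff P k" if "k < i" for k
    using that not_less_Least unfolding i_def by blast
  have j': "c dvd coeff Q k" if "k < j" for k
    using that not_less_Least unfolding j_def by blast
  have "c dvd (\<Sum>k\<in>{..i + j} - {i}. coeff P k * coeff Q (i + j - k))"
  proof (rule dvd_sum)
    fix k assume "k \<in> {..i + j} - {i}"
    then have "k < i \<or> i + j - k < j" by auto
    then show "c dvd coeff P k * coeff Q (i + j - k)"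
      using i' j' by (auto intro: dvd_mult dvd_mult2)
  qed
  moreover have "coeff (P * Q) (i + j) =
      coeff P i * coeff Q j + (\<Sum>k\<in>{..i + j} - {i}. coeff P k * coeff Q (i + j - k))"
    unfolding coeff_mult by (subst sum.remove[of _ i]) auto
  ultimately have "c dvd coeff P i * coeff Q j"
    using PQ[of "i + j"] by (simp add: dvd_add_left_iff)
  with c i j show False by blast
qed

text \<open>
  The induction on the set of variables only yields primality among the polynomials in that set.
  Gauss's argument carries it over to further variables, one at a time.
\<close>
lemma prime_elem_if_prime_relative:
  fixes p :: mpoly
  assumes p: "p \<noteq> 0" "\<not> p dvd 1" "mpoly_vars p \<subseteq> S"
    and prime: "\<And>a b. mpoly_vars a \<subseteq> S \<Longrightarrow> mpoly_vars b \<subseteq> S \<Longrightarrow> p dvd a * b \<Longrightarrow> p dvd a \<or> p dvd b"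
  shows "prime_elem p"
proof (rule prime_elemI)
  have rel: "p dvd a \<or> p dvd b"
    if "finite T" "mpoly_vars a \<subseteq> S \<union> T" "mpoly_vars b \<subseteq> S \<union> T" "p dvd a * b" for T a b
    using that
  proof (induction T arbitrary: a b rule: finite_induct)
    case (insert z T)
    show ?case
    proof (cases "z \<in> S")
      case True
      then show ?thesis using insert.IH[of a b] insert.prems by (simp add: insert_absorb)
    next
      case False
      then have "as_poly z p = [:p:]" using p(3) by (intro as_poly_const) auto
      then have dvd: "[:p:] dvd as_poly z a * as_poly z b"
        using insert.prems(3) as_poly.hom_dvd[of p "a * b" z] by (simp add: as_poly.hom_mult)
      have "(\<forall>i. p dvd coeff (as_poly z a) i) \<or> (\<forall>j. p dvd coeff (as_poly z b) j)"
      proof (rule gauss_content)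
        fix i j
        assume "p dvd coeff (as_poly z a) i * coeff (as_poly z b) j"
        then show "p dvd coeff (as_poly z a) i \<or> p dvd coeff (as_poly z b) j"
          using insert.IH[of "coeff (as_poly z a) i" "coeff (as_poly z b) j"]
            mpoly_vars_coeff_as_poly[of z a i] mpoly_vars_coeff_as_poly[of z b j] insert.prems(1,2)
          by blast
      qed (use dvd in \<open>simp add: const_poly_dvd_iff\<close>)
      then have "[:p:] dvd as_poly z a \<or> [:p:] dvd as_poly z b"
        by (simp add: const_poly_dvd_iff)
      moreover have "p dvd f" if "[:p:] dvd as_poly z f" for f
        using that poly_as_poly[of z f] by (auto elim!: dvdE)
      ultimately show ?thesis by blast
    qed
  qed (use prime in auto)
  fix a b assume "p dvd a * b"
  then show "p dvd a \<or> p dvd b"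
    by (intro rel[of "mpoly_vars a \<union> mpoly_vars b"]) (auto simp: finite_mpoly_vars)
qed (use p in auto)

text \<open>
  Clearing of denominators: the prime factors of \<open>c\<close> are removed one by one from whichever of \<open>h\<close>
  and \<open>k\<close> they divide. Thus a factorisation of \<open>p\<close> over the field of fractions of the
  polynomials in \<open>S\<close> gives one in polynomials.
\<close>
lemma distribute_factors:
  fixes c p h k :: mpoly
  assumes prime: "\<And>q. irreducible q \<Longrightarrow> mpoly_vars q \<subseteq> S \<Longrightarrow> prime_elem q"
    and "c \<noteq> 0" "mpoly_vars c \<subseteq> S" "c * p = h * k"
  obtains c1 c2 h' k' where "c1 \<noteq> 0" "mpoly_vars c1 \<subseteq> S" "h = c1 * h'" "k = c2 * k'" "p = h' * k'"
proof -
  have "\<exists>c1 c2 h' k'. c1 \<noteq> 0 \<and> mpoly_vars c1 \<subseteq> S \<and> h = c1 * h' \<and> k = c2 * k' \<and> p = h' * k'"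
    using assms(2-)
  proof (induction "total_degree c" arbitrary: c h k rule: less_induct)
    case less
    show ?case
    proof (cases "c dvd 1")
      case True
      then obtain u where u: "c * u = 1" by (metis dvdE)
      have "p = h * (k * u)"
      proof -
        have "p = (c * u) * p" by (simp add: u)
        also have "\<dots> = u * (c * p)" by (simp only: mult_ac)
        finally show ?thesis by (simp only: less.prems(3) mult_ac)
      qed
      moreover have "k = c * (k * u)"
      proof -
        have "c * (k * u) = (c * u) * k" by (simp only: mult_ac)
        then show ?thesis by (simp add: u)
      qed
      ultimately show ?thesis
        by (intro exI[of _ 1] exI[of _ c] exI[of _ h] exI[of _ "k * u"]) (auto simp: mpoly_vars_zero_one)
    next
      case False
      with less.prems(1) obtain q where q: "irreducible q" "q dvd c"
        using irreducible_factor_exists by blast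
      then obtain c' where c': "c = q * c'" by (auto elim: dvdE)
      have nz: "q \<noteq> 0" "c' \<noteq> 0" using less.prems(1) c' by auto
      have vars: "mpoly_vars q \<subseteq> S" "mpoly_vars c' \<subseteq> S"
        using mpoly_vars_dvd[of q c] mpoly_vars_dvd[of c' c] less.prems(1,2) c' by auto
      have "total_degree q > 0"
        using q(1) nz total_degree_eq_0[of q] mpoly_unit_if_vars_empty[of q]
        by (auto simp: irreducible_def)
      then have deg: "total_degree c' < total_degree c"
        using c' nz by (simp add: total_degree_mult)
      have eq: "q * (c' * p) = h * k" using less.prems(3) c' by (simp add: mult_ac)
      have "prime_elem q" using prime q(1) vars by blast
      moreover have "q dvd h * k" using eq by (metis dvd_triv_left)
      ultimately consider "q dvd h" | "q dvd k" using prime_elem_dvd_multD by blast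
      then show ?thesis
      proof cases
        case 1
        then obtain h0 where h0: "h = q * h0" by (auto elim: dvdE)
        then have "c' * p = h0 * k" using eq nz by (simp add: mult.assoc)
        from less.hyps[OF deg nz(2) vars(2) this] obtain c1 c2 h' k' where *:
          "c1 \<noteq> 0" "mpoly_vars c1 \<subseteq> S" "h0 = c1 * h'" "k = c2 * k'" "p = h' * k'" by blast
        then show ?thesis
          using h0 nz vars mpoly_vars_mult[of q c1]
          by (intro exI[of _ "q * c1"] exI[of _ c2] exI[of _ h'] exI[of _ k']) (auto simp: mult_ac)
      next
        case 2
        then obtain k0 where k0: "k = q * k0" by (auto elim: dvdE)
        then have "q * (c' * p) = q * (h * k0)" using eq by (simp add: mult_ac)
        then have "c' * p = h * k0" using nz by simp
        from less.hyps[OF deg nz(2) vars(2) this] obtain c1 c2 h' k' where *: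
          "c1 \<noteq> 0" "mpoly_vars c1 \<subseteq> S" "h = c1 * h'" "k0 = c2 * k'" "p = h' * k'" by blast
        then show ?thesis
          using k0
          by (intro exI[of _ "c1"] exI[of _ "q * c2"] exI[of _ h'] exI[of _ k']) (auto simp: mult_ac)
      qed
    qed
  qed
  then show ?thesis using that by blast
qed

text \<open>
  An irreducible polynomial that involves a variable outside \<open>S\<close> has no nonconstant common
  factor with a nonzero polynomial \<open>c\<close> in \<open>S\<close>, hence cancelling \<open>c\<close> preserves divisibility.
\<close>
lemma irreducible_dvd_cancel:
  fixes p :: mpoly
  assumes prime: "\<And>q. irreducible q \<Longrightarrow> mpoly_vars q \<subseteq> S \<Longrightarrow> prime_elem q"
    and p: "irreducible p" "\<not> mpoly_vars p \<subseteq> S"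
    and c: "c \<noteq> 0" "mpoly_vars c \<subseteq> S" "p dvd c * a"
  shows "p dvd a"
proof -
  from c(3) obtain m where "c * a = p * m" by (auto elim: dvdE)
  from distribute_factors[OF prime c(1,2) this] obtain c1 c2 p' m' where
    *: "mpoly_vars c1 \<subseteq> S" "p = c1 * p'" "a = p' * m'" by metis
  have "\<not> p' dvd 1"
    using * p(2) mpoly_vars_mult[of c1 p'] mpoly_vars_unit[of p'] by blast
  with * p(1) have "c1 dvd 1" using irreducibleD by blast
  then obtain u where u: "c1 * u = 1" by (metis dvdE)
  have "p * u = (c1 * u) * p'" by (simp only: *(2) mult_ac)
  then have "p' = p * u" by (simp add: u)
  then show ?thesis using *(3) by auto
qed

text \<open>
  Over the field of fractions of the polynomials in \<open>S\<close>, the polynomials \<open>p\<close> and \<open>a\<close> are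
  coprime in the one variable \<open>y\<close>, and \<open>h\<close> is the denominator in a Bezout identity. Fractions are
  avoided: in the ideal generated by \<open>p\<close> and \<open>a\<close>, a nonzero element \<open>h\<close> of least degree in \<open>y\<close>
  divides every other element up to a factor from \<open>S\<close>. Applied to the irreducible \<open>p\<close>, this
  leaves two possibilities: \<open>h\<close> is free of \<open>y\<close>, or it is a multiple of \<open>p\<close> and then \<open>p\<close> divides \<open>a\<close>.
\<close>
lemma irreducible_elimination:
  fixes p a :: mpoly
  assumes prime: "\<And>q. irreducible q \<Longrightarrow> mpoly_vars q \<subseteq> S \<Longrightarrow> prime_elem q"
    and p: "irreducible p" "mpoly_vars p \<subseteq> insert y S" "y \<in> mpoly_vars p" "y \<notin> S"
    and a: "mpoly_vars a \<subseteq> insert y S" "\<not> p dvd a"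
  obtains h u v where "h \<noteq> 0" "mpoly_vars h \<subseteq> S" "h = u * p + v * a"
proof -
  define R where "R = {f. mpoly_vars f \<subseteq> insert y S}"
  have R_add: "f - g \<in> R" "f * g \<in> R" if "f \<in> R" "g \<in> R" for f g
    using that mpoly_vars_diff[of f g] mpoly_vars_mult[of f g] by (auto simp: R_def)
  define J where "J = {u * p + v * a | u v. u \<in> R \<and> v \<in> R}"
  have R01: "0 \<in> R" "1 \<in> R" by (auto simp: R_def mpoly_vars_zero_one)
  have pJ: "p \<in> J" "a \<in> J"
    unfolding J_def using R01 by (force intro: exI[of _ 1] exI[of _ 0])+
  have "p \<in> R" "a \<in> R" using p a by (auto simp: R_def)
  have J_R: "J \<subseteq> R"
  proof
    fix f assume "f \<in> J"
    then obtain u v where f: "f = u * p + v * a" "u \<in> R" "v \<in> R" unfolding J_def by blast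
    have "f = u * p - (0 - v) * a" by (simp add: f(1))
    then show "f \<in> R" using f \<open>p \<in> R\<close> \<open>a \<in> R\<close> R01 by (simp only: R_add)
  qed
  have J_diff: "r * f - s * g \<in> J" if "r \<in> R" "s \<in> R" "f \<in> J" "g \<in> J" for r s f g
  proof -
    from that obtain u v u' v' where *: "f = u * p + v * a" "g = u' * p + v' * a"
      "u \<in> R" "v \<in> R" "u' \<in> R" "v' \<in> R" unfolding J_def by blast
    have "r * f - s * g = (r * u - s * u') * p + (r * v - s * v') * a"
      by (simp add: * algebra_simps)
    then show ?thesis using * that by (auto simp: J_def intro!: R_add)
  qed
  define d where "d f = degree (as_poly y f)" for f
  define lc where "lc f = lead_coeff (as_poly y f)" for f
  have lc: "mpoly_vars (lc f) \<subseteq> S" "lc f \<in> R" if "f \<in> R" for f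
    using that mpoly_vars_coeff_as_poly[of y f] by (auto simp: lc_def R_def)
  have lc_poly: "as_poly y (lc f) = [:lc f:]" if "f \<in> R" for f
    using lc(1)[OF that] p(4) by (intro as_poly_const) auto
  have "\<exists>h. h \<in> J - {0}" using pJ p(1) by (auto simp: irreducible_def)
  then obtain h where h: "h \<in> J" "h \<noteq> 0" and h_min: "\<And>g. g \<in> J \<Longrightarrow> g \<noteq> 0 \<Longrightarrow> d h \<le> d g"
    using ex_has_least_nat[of "\<lambda>h. h \<in> J - {0}" _ d] by (metis DiffD1 DiffD2 DiffI singletonD singletonI)
  have lch: "lc h \<noteq> 0" using h by (simp add: lc_def as_poly_eq_0_iff)
  have hR: "h \<in> R" using h J_R by auto
  have y_power: "mvar y ^ n \<in> R" for n
    using mpoly_vars_power[of "mvar y" n] by (auto simp: R_def mpoly_vars_mvar)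
  have divide: "\<exists>c k. c \<noteq> 0 \<and> mpoly_vars c \<subseteq> S \<and> c * g = h * k" if "g \<in> J" for g
    using that
  proof (induction "d g" arbitrary: g rule: less_induct)
    case less
    show ?case
    proof (cases "g = 0")
      case True
      then show ?thesis by (intro exI[of _ 1] exI[of _ 0]) (simp add: mpoly_vars_zero_one)
    next
      case False
      have gR: "g \<in> R" using less.prems J_R by auto
      define e where "e = d g - d h"
      have e: "e + d h = d g" using h_min[OF less.prems False] by (simp add: e_def)
      then have "d g - e = d h" "e \<le> d g" by auto
      \<comment> \<open>One step of pseudo-division: the leading terms in \<open>y\<close> cancel.\<close>
      define g1 where "g1 = lc h * g - (lc g * mvar y ^ e) * h"
      have g1J: "g1 \<in> J"
        unfolding g1_def by (intro J_diff R_add lc less.prems h gR hR y_power)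
      have poly_g1: "as_poly y g1 = smult (lc h) (as_poly y g) - smult (lc g) (monom 1 e * as_poly y h)"
        by (simp add: g1_def hom_distribs lc_poly gR hR as_poly_mvar monom_altdef)
      have "as_poly y g1 = 0 \<or> degree (as_poly y g1) < d g"
      proof (rule eq_zero_or_degree_less)
        have "degree (monom 1 e * as_poly y h) \<le> d g"
          using degree_mult_le[of "monom 1 e" "as_poly y h"] degree_monom_le[of "1::mpoly" e] e
          by (simp add: d_def)
        then show "degree (as_poly y g1) \<le> d g"
          unfolding poly_g1
          by (intro degree_diff_le order_trans[OF degree_smult_le]) (auto simp: d_def)
        have "coeff (monom 1 e * as_poly y h) (d g) = lc h"
          using \<open>d g - e = d h\<close> \<open>e \<le> d g\<close> by (auto simp: coeff_monom_mult lc_def d_def)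
        then show "coeff (as_poly y g1) (d g) = 0"
          unfolding poly_g1 by (simp add: lc_def d_def mult.commute)
      qed
      then consider "g1 = 0" | "d g1 < d g" by (auto simp: d_def as_poly_eq_0_iff)
      then show ?thesis
      proof cases
        case 1
        then have "lc h * g = h * (lc g * mvar y ^ e)" by (simp add: g1_def mult_ac)
        then show ?thesis using lch lc(1)[OF hR] by blast
      next
        case 2
        from less.hyps[OF this g1J] obtain c k where ck: "c \<noteq> 0" "mpoly_vars c \<subseteq> S" "c * g1 = h * k"
          by blast
        have "(c * lc h) * g = c * g1 + h * (c * lc g * mvar y ^ e)"
          by (simp add: g1_def algebra_simps)
        also have "\<dots> = h * (k + c * lc g * mvar y ^ e)"
          by (simp add: ck algebra_simps)
        finally have "(c * lc h) * g = h * (k + c * lc g * mvar y ^ e)" .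
        moreover have "mpoly_vars (c * lc h) \<subseteq> S"
          using mpoly_vars_mult[of c "lc h"] ck lc(1)[OF hR] by blast
        moreover have "c * lc h \<noteq> 0" using ck lch by simp
        ultimately show ?thesis by blast
      qed
    qed
  qed
  from divide[OF pJ(1)] obtain c k where ck: "c \<noteq> 0" "mpoly_vars c \<subseteq> S" "c * p = h * k" by blast
  from distribute_factors[OF prime ck] obtain c1 c2 h' k' where
    c1: "c1 \<noteq> 0" "mpoly_vars c1 \<subseteq> S" "h = c1 * h'" "p = h' * k'" by metis
  have "\<not> k' dvd 1"
  proof
    assume "k' dvd 1"
    then obtain u where "k' * u = 1" by (metis dvdE)
    then have "h' = p * u" by (simp add: c1(4) mult.assoc)
    then have "p dvd h" using c1(3) by simp
    moreover obtain c' k'' where c': "c' \<noteq> 0" "mpoly_vars c' \<subseteq> S" "c' * a = h * k''"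
      using divide[OF pJ(2)] by blast
    ultimately have "p dvd c' * a" by simp
    then have "p dvd a"
      using irreducible_dvd_cancel[OF prime p(1) _ c'(1,2)] p(3,4) by blast
    with a(2) show False by simp
  qed
  then have "h' dvd 1" using p(1) c1(4) irreducibleD by blast
  then have "mpoly_vars h \<subseteq> S"
    using mpoly_vars_mult[of c1 h'] c1 mpoly_vars_unit[of h'] by auto
  with h that show ?thesis unfolding J_def by blast
qed

text \<open>
  Let \<open>p\<close> divide \<open>a b\<close> but not \<open>a\<close>. Elimination of \<open>y\<close> gives \<open>h = u p + v a\<close> without \<open>y\<close>. Then \<open>p\<close>
  divides \<open>h b\<close>, and \<open>h\<close> can be cancelled.
\<close>
theorem irreducible_imp_prime_elem_mpoly:
  fixes p :: mpoly
  assumes "irreducible p"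
  shows "prime_elem p"
proof -
  have "prime_elem p" if "finite S" "irreducible p" "mpoly_vars p \<subseteq> S" for S and p :: mpoly
    using that
  proof (induction S arbitrary: p rule: finite_induct)
    case empty
    then show ?case using mpoly_unit_if_vars_empty[of p] by (auto simp: irreducible_def)
  next
    case (insert y S)
    show ?case
    proof (cases "y \<in> mpoly_vars p")
      case False
      then show ?thesis using insert by blast
    next
      case True
      show ?thesis
      proof (rule prime_elem_if_prime_relative)
        show "p \<noteq> 0" "\<not> p dvd 1" "mpoly_vars p \<subseteq> insert y S"
          using insert.prems by (auto simp: irreducible_def)
        fix a b
        assume ab: "mpoly_vars a \<subseteq> insert y S" "mpoly_vars b \<subseteq> insert y S" "p dvd a * b"
        show "p dvd a \<or> p dvd b"
        proof (cases "p dvd a")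
          case False
          with irreducible_elimination[OF insert.IH insert.prems True insert.hyps(2) ab(1)]
          obtain h u v where h: "h \<noteq> 0" "mpoly_vars h \<subseteq> S" "h = u * p + v * a" by blast
          have "h * b = p * (u * b) + v * (a * b)" by (simp add: h algebra_simps)
          then have "p dvd h * b" using ab(3) by (metis dvd_add dvd_mult dvd_triv_left)
          then have "p dvd b"
            using irreducible_dvd_cancel[OF insert.IH insert.prems(1) _ h(1,2)] True insert.hyps(2)
            by blast
          then show ?thesis ..
        qed simp
      qed
    qed
  qed
  then show ?thesis using assms finite_mpoly_vars by blast
qed

section \<open>Evaluation\<close>

lemma comm_ring_hom_mpoly_eval: "comm_ring_hom (mpoly_eval x)"
  unfolding mpoly_eval_eq_hom_ext by (rule comm_ring_hom_hom_ext[OF comm_ring_hom_ident])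

interpretation mpoly_eval: comm_ring_hom "mpoly_eval x" for x
  by (rule comm_ring_hom_mpoly_eval)

lemma mpoly_eval_mvar: "mpoly_eval x (mvar i) = x i"
  by (simp add: mpoly_eval_eq_hom_ext hom_ext_mvar[OF comm_ring_hom_ident])

lemma mpoly_eval_mconst: "mpoly_eval x (mconst c) = c"
  by (simp add: mpoly_eval_eq_hom_ext hom_ext_mconst[OF comm_ring_hom_ident])

lemma mpoly_eval_cong: "(\<And>i. i \<in> mpoly_vars f \<Longrightarrow> x i = y i) \<Longrightarrow> mpoly_eval x f = mpoly_eval y f"
  unfolding mpoly_eval_eq_hom_ext by (rule hom_ext_cong) auto

lemma mpoly_eval_subst:
  "mpoly_eval x (hom_ext mconst s f) = mpoly_eval (\<lambda>i. mpoly_eval x (s i)) f"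
  by (simp add: hom_hom_ext[OF comm_ring_hom_mpoly_eval] mpoly_eval_mconst flip: mpoly_eval_eq_hom_ext)

lemma comm_ring_hom_map_poly:
  assumes "comm_ring_hom (h :: 'a::comm_ring_1 \<Rightarrow> 'b::comm_ring_1)"
  shows "comm_ring_hom (map_poly h)"
proof -
  interpret h: comm_ring_hom h by fact
  show ?thesis
    by standard (auto intro!: poly_eqI simp: coeff_map_poly coeff_mult hom_distribs)
qed

lemma poly_map_as_poly:
  "poly (map_poly (mpoly_eval x) (as_poly y f)) t = mpoly_eval (x(y := t)) f"
proof -
  have X: "map_poly (mpoly_eval x) [:a:] = [:mpoly_eval x a:]" for a
    by (simp add: map_poly_pCons)
  have "poly (map_poly (mpoly_eval x) (as_poly y f)) t = hom_ext (\<lambda>c. c) (x(y := t)) f"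
    unfolding as_poly_def hom_hom_ext[OF comm_ring_hom_map_poly[OF comm_ring_hom_mpoly_eval]]
      hom_hom_ext[OF comm_ring_hom_poly]
    by (rule hom_ext_cong) (auto simp: map_poly_pCons mpoly_eval_mvar mpoly_eval_mconst)
  then show ?thesis by (simp add: mpoly_eval_eq_hom_ext)
qed

text \<open>
  The leading coefficient with respect to one variable has fewer variables; where it does not
  vanish, a nonzero univariate polynomial in that variable remains.
\<close>
lemma mpoly_nonzero_point:
  assumes "f \<noteq> 0"
  shows "\<exists>x. mpoly_eval x f \<noteq> 0"
  using assms
proof (induction "card (mpoly_vars f)" arbitrary: f rule: less_induct)
  case less
  show ?case
  proof (cases "mpoly_vars f = {}")
    case True
    then show ?thesis
      using mpoly_eq_mconst_if_vars_empty[OF True] less.prems mpoly_eval_mconst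
      by (metis mconst_def single_zero)
  next
    case False
    then obtain y where y: "y \<in> mpoly_vars f" by blast
    define c where "c = lead_coeff (as_poly y f)"
    have "c \<noteq> 0" using less.prems by (simp add: c_def as_poly_eq_0_iff)
    moreover have "card (mpoly_vars c) < card (mpoly_vars f)"
      using y mpoly_vars_coeff_as_poly[of y f] unfolding c_def
      by (intro psubset_card_mono finite_mpoly_vars) blast
    ultimately obtain x where "mpoly_eval x c \<noteq> 0" using less.hyps by blast
    then have "map_poly (mpoly_eval x) (as_poly y f) \<noteq> 0"
      unfolding c_def by (metis coeff_0 coeff_map_poly mpoly_eval.hom_zero)
    then obtain t where "poly (map_poly (mpoly_eval x) (as_poly y f)) t \<noteq> 0"
      using poly_all_0_iff_0 by blast
    then show ?thesis unfolding poly_map_as_poly by blast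
  qed
qed

text \<open>
  Eliminate a variable \<open>y\<close> of \<open>p\<close> between \<open>p\<close> and \<open>g\<close>, giving \<open>h = u p + v g\<close>. Choose the other
  coordinates so that neither \<open>h\<close> nor the leading coefficient of \<open>p\<close> in \<open>y\<close> vanishes, and then
  \<open>y\<close> as a root of \<open>p\<close>. At this point \<open>v g = h\<close> is nonzero.
\<close>
lemma hypersurface_nullstellensatz:
  assumes p: "irreducible p" and g: "\<not> p dvd g"
  obtains x where "mpoly_eval x p = 0" "mpoly_eval x g \<noteq> 0"
proof -
  have "mpoly_vars p \<noteq> {}"
    using p mpoly_unit_if_vars_empty[of p] by (auto simp: irreducible_def)
  then obtain y where y: "y \<in> mpoly_vars p" by blast
  define S where "S = mpoly_vars p \<union> mpoly_vars g - {y}"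
  obtain h u v where h: "h \<noteq> 0" "mpoly_vars h \<subseteq> S" "h = u * p + v * g"
    by (rule irreducible_elimination[of S p y g])
       (use irreducible_imp_prime_elem_mpoly p g y in \<open>auto simp: S_def\<close>)
  define c where "c = lead_coeff (as_poly y p)"
  have "c \<noteq> 0" using p by (auto simp: c_def as_poly_eq_0_iff irreducible_def)
  then have "h * c \<noteq> 0" using h by simp
  then obtain x where "mpoly_eval x (h * c) \<noteq> 0" using mpoly_nonzero_point by blast
  then have hx: "mpoly_eval x h \<noteq> 0" and cx: "mpoly_eval x c \<noteq> 0" by (auto simp: mpoly_eval.hom_mult)
  define P where "P = map_poly (mpoly_eval x) (as_poly y p)"
  have "degree (as_poly y p) \<le> degree P"
    using cx by (intro le_degree) (simp add: P_def c_def coeff_map_poly)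
  then have "degree P \<noteq> 0" using y degree_as_poly_eq_0_iff[of y p] by simp
  then obtain t where "poly P t = 0"
    using fundamental_theorem_of_algebra[of P] constant_degree[of P] by auto
  then have root: "mpoly_eval (x(y := t)) p = 0" by (simp add: P_def poly_map_as_poly)
  have "mpoly_eval (x(y := t)) h = mpoly_eval x h"
    using h(2) by (intro mpoly_eval_cong) (auto simp: S_def)
  then have "mpoly_eval (x(y := t)) g \<noteq> 0"
    using hx root h(3) by (auto simp: mpoly_eval.hom_add mpoly_eval.hom_mult)
  with root that show ?thesis by blast
qed

text \<open>
  On the line a polynomial is univariate, and it is not the zero polynomial if it is nonzero at
  parameter 1. This yields points arbitrarily close to \<open>z\<close> outside a hypersurface.
\<close>
lemma eventually_mpoly_line_nonzero:
  assumes "mpoly_eval (\<lambda>i. z i + d i) f \<noteq> 0"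
  shows "eventually (\<lambda>t. mpoly_eval (\<lambda>i. z i + t * d i) f \<noteq> 0) (at 0)"
proof -
  define P where "P = hom_ext (\<lambda>c. [:c:]) (\<lambda>i. [:z i, d i:]) f"
  have P: "poly P t = mpoly_eval (\<lambda>i. z i + t * d i) f" for t
    unfolding P_def mpoly_eval_eq_hom_ext hom_hom_ext[OF comm_ring_hom_poly] by simp
  from assms P[of 1] have "P \<noteq> 0" by auto
  then have "finite {t. poly P t = 0}" by (rule poly_roots_finite)
  then have "open (- ({t. poly P t = 0} - {0}))"
    by (intro open_Compl finite_imp_closed) auto
  then have "eventually (\<lambda>t. t \<notin> {t. poly P t = 0}) (at 0)"
    unfolding eventually_at_topological by blast
  then show ?thesis by (simp add: P)
qed

lemma tendsto_mpoly_line: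
  "((\<lambda>t. mpoly_eval (\<lambda>i. z i + t * d i) f) \<longlongrightarrow> mpoly_eval z f) (at 0)"
proof -
  have "((\<lambda>t. mpoly_eval (\<lambda>i. z i + t * d i) f) \<longlongrightarrow> mpoly_eval (\<lambda>i. z i + 0 * d i) f) (at 0)"
    unfolding mpoly_eval_def by (intro tendsto_intros)
  then show ?thesis by simp
qed

section \<open>Symbolic execution\<close>

text \<open>
  The first \<open>n\<close> variables have been replaced by polynomials in them that are generic modulo \<open>p\<close>;
  the others are still untouched and available as fresh variables.
\<close>
definition generic_subst :: "mpoly \<Rightarrow> nat \<Rightarrow> (nat \<Rightarrow> mpoly) \<Rightarrow> bool" where
  "generic_subst p n s \<longleftrightarrow>
     (\<forall>i\<ge>n. s i = mvar i) \<and> (\<forall>i<n. mpoly_vars (s i) \<subseteq> {..<n}) \<and>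
     (\<forall>f. p dvd hom_ext mconst s f \<longrightarrow> p dvd f)"

lemma generic_subst_mvar: "generic_subst p n mvar"
  by (simp add: generic_subst_def hom_ext_mconst_mvar mpoly_vars_mvar)

lemma generic_subst_mono:
  assumes s: "generic_subst p n s" and n: "n \<le> n'"
  shows "generic_subst p n' s"
  unfolding generic_subst_def
proof (intro conjI allI impI)
  fix i assume "i < n'"
  show "mpoly_vars (s i) \<subseteq> {..<n'}"
  proof (cases "i < n")
    case True
    then have "mpoly_vars (s i) \<subseteq> {..<n}" using s by (simp add: generic_subst_def)
    also have "\<dots> \<subseteq> {..<n'}" using n by auto
    finally show ?thesis .
  next
    case False
    then have "s i = mvar i" using s by (simp add: generic_subst_def)
    then show ?thesis using \<open>i < n'\<close> by (simp add: mpoly_vars_mvar)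
  qed
qed (use s n in \<open>simp_all add: generic_subst_def\<close>)

text \<open>
  Translate the fresh variable \<open>y\<close> with index \<open>n\<close> by \<open>-1\<close>, which does not affect \<open>p\<close>. Then the
  new substitution sends that variable to \<open>w y\<close>, and it sends \<open>f\<close>, written as \<open>\<Sum>k. f\<^sub>k y^k\<close>, to
  \<open>\<Sum>k. g\<^sub>k w^k y^k\<close>, where \<open>g\<^sub>k\<close> is obtained from \<open>f\<^sub>k\<close> by the old substitution. If \<open>p\<close> divides
  this sum, then it divides each \<open>g\<^sub>k w^k\<close>, by primality each \<open>g\<^sub>k\<close>, hence each \<open>f\<^sub>k\<close>.
\<close>
lemma generic_subst_extend:
  assumes s: "generic_subst p n s" and p: "prime_elem p" "n \<notin> mpoly_vars p"
    and w: "mpoly_vars w \<subseteq> {..<n}" "\<not> p dvd w"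
  shows "generic_subst p (Suc n) (s(n := w * (1 + mvar n)))"
  unfolding generic_subst_def
proof (intro conjI allI impI)
  let ?s = "s(n := w * (1 + mvar n))"
  fix i
  show "?s i = mvar i" if "i \<ge> Suc n" using that s by (simp add: generic_subst_def)
  show "mpoly_vars (?s i) \<subseteq> {..<Suc n}" if "i < Suc n"
  proof (cases "i = n")
    case True
    have "mpoly_vars (w * (1 + mvar n)) \<subseteq> mpoly_vars w \<union> {n}"
      using mpoly_vars_mult[of w "1 + mvar n"] mpoly_vars_add[of 1 "mvar n"]
      by (auto simp: mpoly_vars_zero_one mpoly_vars_mvar)
    then show ?thesis using True w by auto
  next
    case False
    with that have "i < n" by simp
    then have "mpoly_vars (s i) \<subseteq> {..<n}" using s unfolding generic_subst_def by blast
    then show ?thesis using False by auto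
  qed
next
  let ?s = "s(n := w * (1 + mvar n))"
  fix f assume dvd: "p dvd hom_ext mconst ?s f"
  define shift where
    "shift = hom_ext (\<lambda>c. [:mconst c:]) (\<lambda>i. if i = n then [:-1, 1:] else [:mvar i:])"
  have hom_shift: "comm_ring_hom shift"
    unfolding shift_def by (rule comm_ring_hom_hom_ext[OF comm_ring_hom_const_mconst])
  interpret shift: comm_ring_hom shift by (rule hom_shift)
  have shift_const: "shift g = [:g:]" if "n \<notin> mpoly_vars g" for g
    unfolding hom_eq_hom_ext[OF comm_ring_hom_const_poly, of g] shift_def
    using that by (intro hom_ext_cong) auto
  have shift_n: "shift (mvar n) = [:-1, 1:]"
    by (simp add: shift_def hom_ext_mvar[OF comm_ring_hom_const_mconst])
  have s_n: "n \<notin> mpoly_vars (s i)" if "i \<noteq> n" for i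
    using that s unfolding generic_subst_def
    by (metis lessThan_iff mpoly_vars_mvar not_less_iff_gr_or_eq order.strict_implies_order singletonD subsetD)
  define subst where "subst = hom_ext mconst s"
  have hom_subst: "comm_ring_hom subst"
    unfolding subst_def by (rule comm_ring_hom_hom_ext[OF comm_ring_hom_mconst])
  \<comment> \<open>\<open>T\<close> applies the old substitution to the coefficients and sends the main variable \<open>y\<close> to \<open>w y\<close>.\<close>
  define T where "T P = pcompose (map_poly subst P) [:0, w:]" for P
  have "comm_ring_hom (\<lambda>P. pcompose P [:0, w:])"
    by standard (simp_all add: pcompose_add pcompose_mult pcompose_1)
  then have hom_T: "comm_ring_hom T"
    unfolding T_def by (rule comm_ring_hom_comp) (rule comm_ring_hom_map_poly[OF hom_subst])
  interpret subst: comm_ring_hom subst by (rule hom_subst)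
  have "shift (hom_ext mconst ?s f) = T (as_poly n f)"
    unfolding hom_hom_ext[OF hom_shift] as_poly_def hom_hom_ext[OF hom_T]
  proof (rule hom_ext_cong)
    fix c
    have "subst (mconst c) = mconst c"
      by (simp add: subst_def hom_ext_mconst[OF comm_ring_hom_mconst])
    then show "shift (mconst c) = T [:mconst c:]"
      by (simp add: shift_const mpoly_vars_mconst T_def map_poly_pCons)
  next
    fix i
    have subst_mvar: "subst (mvar i) = s i"
      by (simp add: subst_def hom_ext_mvar[OF comm_ring_hom_mconst])
    show "shift (?s i) = T (if i = n then [:0, 1:] else [:mvar i:])"
    proof (cases "i = n")
      case True
      have "n \<notin> mpoly_vars w" using w by auto
      then show ?thesis
        using True by (simp add: shift.hom_mult shift.hom_add shift_const shift_n T_def map_poly_pCons one_pCons pcompose_pCons)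
    next
      case False
      then show ?thesis
        by (simp add: shift_const s_n T_def map_poly_pCons subst_mvar)
    qed
  qed
  moreover have "[:p:] dvd shift (hom_ext mconst ?s f)"
    using shift.hom_dvd[OF dvd] shift_const[OF p(2)] by simp
  ultimately have "p dvd coeff (T (as_poly n f)) k" for k
    by (simp add: const_poly_dvd_iff)
  then have "p dvd w ^ k * subst (coeff (as_poly n f) k)" for k
    by (simp add: T_def coeff_pcompose_linear coeff_map_poly)
  then have "p dvd subst (coeff (as_poly n f) k)" for k
    using p(1) w(2) prime_elem_dvd_multD prime_elem_dvd_power by blast
  then have "p dvd coeff (as_poly n f) k" for k
    using s by (simp add: subst_def generic_subst_def)
  then have "[:p:] dvd as_poly n f" by (simp add: const_poly_dvd_iff)
  then obtain k where "as_poly n f = [:p:] * k" by (rule dvdE)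
  then have "f = p * poly k (mvar n)"
    by (subst poly_as_poly[of n f, symmetric]) simp
  then show "p dvd f" by simp
qed

text \<open>
  In symbolic values the variables below \<open>N\<close> stand for the inputs and the variable \<open>N + v\<close> for the
  rounding error of node \<open>v\<close>.
\<close>
definition run_point :: "nat \<Rightarrow> complex vec \<Rightarrow> (nat \<Rightarrow> complex) \<Rightarrow> nat \<Rightarrow> complex" where
  "run_point N x \<delta> i = (if i < N then x $ i else \<delta> (i - N))"

text \<open>
  Every stored value is the image, under a generic substitution, of a polynomial of degree at most
  1. Those that occur are 0 and the variables up to sign: inputs, results of operations, and
  their negatives.
\<close>
definition symbolic_env ::
  "mpoly \<Rightarrow> nat \<Rightarrow> nat \<Rightarrow> (nat \<Rightarrow> mpoly) \<Rightarrow> (nat \<rightharpoonup> mpoly) \<Rightarrow> bool" where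
  "symbolic_env p N n s \<sigma> \<longleftrightarrow> N \<le> n \<and> generic_subst p n s \<and> (\<forall>i<N. s i = mvar i) \<and>
     (\<forall>a f. \<sigma> a = Some f \<longrightarrow>
       (\<exists>l. f = hom_ext mconst s l \<and> total_degree l \<le> 1 \<and> mpoly_vars l \<subseteq> {..<n}))"

lemma total_degree_zero: "total_degree 0 = 0"
  by (simp add: total_degree_def)

lemma total_degree_mvar: "total_degree (mvar i) = 1"
  by (simp add: total_degree_def mvar_def)

lemma total_degree_uminus: "total_degree (- f) = total_degree f"
  by (simp add: homogenize.hom_uminus flip: degree_homogenize)

lemma total_degree_dvd_le: "p dvd f \<Longrightarrow> f \<noteq> 0 \<Longrightarrow> total_degree p \<le> total_degree f"
  by (auto elim!: dvdE simp: total_degree_mult)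

lemma symbolic_env_mono:
  assumes env: "symbolic_env p N n s \<sigma>" and n: "n \<le> n'"
  shows "symbolic_env p N n' s \<sigma>"
  unfolding symbolic_env_def
proof (intro conjI allI impI)
  show "N \<le> n'" "generic_subst p n' s"
    using env n generic_subst_mono[of p n s n'] by (simp_all add: symbolic_env_def)
  show "s i = mvar i" if "i < N" for i
    using env that by (simp add: symbolic_env_def)
  fix a f assume "\<sigma> a = Some f"
  then obtain l where l: "f = hom_ext mconst s l" "total_degree l \<le> 1" "mpoly_vars l \<subseteq> {..<n}"
    using env unfolding symbolic_env_def by blast
  have "{..<n} \<subseteq> {..<n'}" using n by auto
  with l(3) have "mpoly_vars l \<subseteq> {..<n'}" by (rule subset_trans)
  with l(1,2) show "\<exists>l. f = hom_ext mconst s l \<and> total_degree l \<le> 1 \<and> mpoly_vars l \<subseteq> {..<n'}"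
    by (intro exI[of _ l] conjI)
qed

lemma symbolic_env_update:
  assumes env: "symbolic_env p N n s \<sigma>" and l: "total_degree l \<le> 1" "mpoly_vars l \<subseteq> {..<n}"
  shows "symbolic_env p N n s (\<sigma>(v \<mapsto> hom_ext mconst s l))"
  unfolding symbolic_env_def
proof (intro conjI allI impI)
  fix a f assume f: "(\<sigma>(v \<mapsto> hom_ext mconst s l)) a = Some f"
  show "\<exists>l. f = hom_ext mconst s l \<and> total_degree l \<le> 1 \<and> mpoly_vars l \<subseteq> {..<n}"
  proof (cases "a = v")
    case True
    then have "f = hom_ext mconst s l" using f by simp
    then show ?thesis using l by (intro exI[of _ l] conjI)
  next
    case False
    then have "\<sigma> a = Some f" using f by simp
    then show ?thesis using env unfolding symbolic_env_def by blast
  qed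
qed (use env in \<open>simp_all add: symbolic_env_def\<close>)

lemma symbolic_env_extend:
  assumes env: "symbolic_env p N n s \<sigma>" and p: "prime_elem p" "n \<notin> mpoly_vars p"
    and w: "mpoly_vars w \<subseteq> {..<n}" "\<not> p dvd w"
  shows "symbolic_env p N (Suc n) (s(n := w * (1 + mvar n))) (\<sigma>(v \<mapsto> w * (1 + mvar n)))"
    (is "symbolic_env p N (Suc n) ?s _")
proof -
  have ext: "symbolic_env p N (Suc n) ?s \<sigma>"
    unfolding symbolic_env_def
  proof (intro conjI allI impI)
    fix a f assume "\<sigma> a = Some f"
    then obtain l where l: "f = hom_ext mconst s l" "total_degree l \<le> 1" "mpoly_vars l \<subseteq> {..<n}"
      using env unfolding symbolic_env_def by blast
    have "hom_ext mconst s l = hom_ext mconst ?s l"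
      using l(3) by (intro hom_ext_cong) auto
    with l show "\<exists>l. f = hom_ext mconst ?s l \<and> total_degree l \<le> 1 \<and> mpoly_vars l \<subseteq> {..<Suc n}"
      by (intro exI[of _ l]) auto
  next
    fix i assume "i < N"
    then show "?s i = mvar i" using env by (simp add: symbolic_env_def)
  next
    show "N \<le> Suc n" "generic_subst p (Suc n) ?s"
      using env generic_subst_extend[OF _ p w, of s] by (simp_all add: symbolic_env_def)
  qed
  have "w * (1 + mvar n) = hom_ext mconst ?s (mvar n)"
    by (simp add: hom_ext_mvar[OF comm_ring_hom_mconst])
  then show ?thesis
    using symbolic_env_update[OF ext, of "mvar n" v]
    by (simp add: total_degree_mvar mpoly_vars_mvar)
qed

text \<open>
  Symbolic execution from node \<open>v\<close>, following both successors of every branching node. A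
  computational node applies an operation to the images of polynomials of degree at most 1, so
  without its rounding error it yields the image of a polynomial \<open>q'\<close> of degree less than that
  of \<open>p\<close>. Either \<open>q'\<close> is 0, or neither \<open>q'\<close> nor its image is divisible by \<open>p\<close> and the result
  becomes a new generic value. The same comparison of degrees applies to the output.
\<close>
lemma symbolic_results:
  fixes p :: mpoly
  assumes nodes: "\<And>v. v < length G \<Longrightarrow> admissible_node B C N (G ! v) \<and> (\<forall>w\<in>successors (G ! v). v < w \<and> w < length G)"
    and p: "irreducible p" "mpoly_vars p \<subseteq> {..<N}" "total_degree p > 1"
    and B: "\<And>q. q \<in> B \<Longrightarrow> total_degree q < total_degree p"
    and env: "symbolic_env p N (N + v) s \<sigma>"
  shows "\<exists>F. finite F \<and> (\<forall>f\<in>F. f = 0 \<or> \<not> p dvd f) \<and>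
     (\<forall>x \<delta> r. runs G x \<delta> v (\<lambda>a. map_option (mpoly_eval (run_point N x \<delta>)) (\<sigma> a)) r \<longrightarrow>
        r \<in> (\<lambda>f. mpoly_eval (run_point N x \<delta>) f) ` F)"
    (is "\<exists>F. ?results v \<sigma> F")
  using env
proof (induction "length G - v" arbitrary: v s \<sigma> rule: less_induct)
  case less
  let ?E = "\<lambda>x \<delta>. mpoly_eval (run_point N x \<delta>)"
  let ?env = "\<lambda>\<sigma> x \<delta> a. map_option (?E x \<delta>) (\<sigma> a)"
  note prime = irreducible_imp_prime_elem_mpoly[OF p(1)]
  have env_upd: "?env (\<sigma>(v \<mapsto> f)) x \<delta> = (?env \<sigma> x \<delta>)(v \<mapsto> ?E x \<delta> f)" for f x \<delta>
    by (auto simp: fun_eq_iff)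
  have generic: "p dvd f" if "p dvd hom_ext mconst s f" for f
    using that less.prems by (simp add: symbolic_env_def generic_subst_def)
  have small: "f = 0" if "p dvd hom_ext mconst s f" "total_degree f < total_degree p" for f
    using total_degree_dvd_le[OF generic[OF that(1)]] that(2) by auto
  have next_node: "\<exists>F. ?results w \<sigma>' F" if "symbolic_env p N (Suc (N + v)) s' \<sigma>'" "v < length G" "v < w" for s' \<sigma>' w
  proof (rule less.hyps)
    show "length G - w < length G - v" using that by auto
    show "symbolic_env p N (N + w) s' \<sigma>'"
      using that by (elim symbolic_env_mono) auto
  qed
  have step: "symbolic_env p N (Suc (N + v)) s (\<sigma>(v \<mapsto> hom_ext mconst s l))"
    if "total_degree l \<le> 1" "mpoly_vars l \<subseteq> {..<N + v}" for l
    using symbolic_env_mono[OF symbolic_env_update[OF less.prems that]] by auto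
  show ?case
  proof (cases "v < length G")
    case False
    then have "\<not> runs G x \<delta> v e r" for x \<delta> e r by (auto elim: runs.cases)
    then show ?thesis by (intro exI[of _ "{}"]) auto
  next
    case v: True
    show ?thesis
    proof (cases "G ! v")
      case (Input i w)
      then have i: "i < N" "v < w" using nodes[OF v] by auto
      then have si: "hom_ext mconst s (mvar i) = mvar i"
        using less.prems by (simp add: symbolic_env_def hom_ext_mvar[OF comm_ring_hom_mconst])
      have "symbolic_env p N (Suc (N + v)) s (\<sigma>(v \<mapsto> mvar i))"
        using step[of "mvar i"] i by (simp add: si total_degree_mvar mpoly_vars_mvar)
      from next_node[OF this v i(2)] obtain F where F: "?results w (\<sigma>(v \<mapsto> mvar i)) F" by blast
      have "runs G x \<delta> w (?env (\<sigma>(v \<mapsto> mvar i)) x \<delta>) r" if "runs G x \<delta> v (?env \<sigma> x \<delta>) r" for x \<delta> r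
        using that Input i unfolding env_upd
        by (cases rule: runs.cases) (simp_all add: mpoly_eval_mvar run_point_def del: fun_upd_apply)
      then have "?results v \<sigma> F" using F by blast
      then show ?thesis by blast
    next
      case (Compute q as w)
      then have q: "q \<in> B" "mpoly_vars q \<subseteq> {..<length as}" "v < w" using nodes[OF v] by auto
      show ?thesis
      proof (cases "set as \<subseteq> dom \<sigma>")
        case False
        have "\<not> runs G x \<delta> v (?env \<sigma> x \<delta>) r" for x \<delta> r
        proof
          assume "runs G x \<delta> v (?env \<sigma> x \<delta>) r"
          then show False
            using False Compute by (cases rule: runs.cases) (auto simp: dom_def)
        qed
        then show ?thesis by (intro exI[of _ "{}"]) auto
      next
        case True
        have "\<exists>l. the (\<sigma> (as ! i)) = hom_ext mconst s l \<and> total_degree l \<le> 1 \<and> mpoly_vars l \<subseteq> {..<N + v}"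
          if "i < length as" for i
        proof -
          from that True obtain f where "\<sigma> (as ! i) = Some f" by (metis domD nth_mem subsetD)
          then show ?thesis using less.prems unfolding symbolic_env_def by (metis option.sel)
        qed
        then obtain L where L: "\<And>i. i < length as \<Longrightarrow> the (\<sigma> (as ! i)) = hom_ext mconst s (L i) \<and>
            total_degree (L i) \<le> 1 \<and> mpoly_vars (L i) \<subseteq> {..<N + v}"
          by metis
        \<comment> \<open>Only the inputs of the node matter; beyond them 0 keeps the degree bound valid.\<close>
        define L' where "L' i = (if i < length as then L i else 0)" for i
        define q' where "q' = hom_ext mconst L' q"
        have deg_q': "total_degree q' < total_degree p"
          unfolding q'_def using L B[OF q(1)]
          by (intro le_less_trans[OF total_degree_subst_le]) (auto simp: L'_def total_degree_zero)
        have vars_q': "mpoly_vars q' \<subseteq> {..<N + v}"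
          unfolding q'_def using L q(2) by (intro mpoly_vars_subst) (auto simp: L'_def)
        define g where "g = hom_ext mconst s q'"
        have "mpoly_vars g \<subseteq> {..<N + v}"
          unfolding g_def using vars_q' less.prems
          by (intro mpoly_vars_subst) (auto simp: symbolic_env_def generic_subst_def)
        define val where "val = g * (1 + mvar (N + v))"
        have eval_g: "?E x \<delta> g = mpoly_eval (\<lambda>i. the (?env \<sigma> x \<delta> (as ! i))) q" for x \<delta>
        proof -
          have "?E x \<delta> g = mpoly_eval (\<lambda>i. ?E x \<delta> (hom_ext mconst s (L' i))) q"
            by (simp add: g_def q'_def mpoly_eval_subst)
          also have "\<dots> = mpoly_eval (\<lambda>i. the (?env \<sigma> x \<delta> (as ! i))) q"
          proof (rule mpoly_eval_cong)
            fix i assume "i \<in> mpoly_vars q"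
            then have i: "i < length as" using q(2) by auto
            then obtain f where "\<sigma> (as ! i) = Some f" using True by (metis domD nth_mem subsetD)
            then show "?E x \<delta> (hom_ext mconst s (L' i)) = the (?env \<sigma> x \<delta> (as ! i))"
              using L[OF i] i by (simp add: L'_def)
          qed
          finally show ?thesis .
        qed
        have eval_val: "?E x \<delta> val = mpoly_eval (\<lambda>i. the (?env \<sigma> x \<delta> (as ! i))) q * (1 + \<delta> v)" for x \<delta>
          unfolding val_def mpoly_eval.hom_mult eval_g
          by (simp add: mpoly_eval.hom_add mpoly_eval_mvar run_point_def)
        have "\<exists>s'. symbolic_env p N (Suc (N + v)) s' (\<sigma>(v \<mapsto> val))"
        proof (cases "q' = 0")
          case True
          then have "val = hom_ext mconst s 0"
            by (simp add: val_def g_def hom_ext_zero[OF comm_ring_hom_mconst])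
          then show ?thesis
            using step[of 0] by (auto simp: total_degree_zero mpoly_vars_zero_one)
        next
          case False
          then have "\<not> p dvd g" using small[of q'] deg_q' by (auto simp: g_def)
          moreover have "N + v \<notin> mpoly_vars p" using p(2) by auto
          ultimately show ?thesis
            unfolding val_def
            using symbolic_env_extend[OF less.prems prime] \<open>mpoly_vars g \<subseteq> {..<N + v}\<close> by blast
        qed
        then obtain s' where "symbolic_env p N (Suc (N + v)) s' (\<sigma>(v \<mapsto> val))" by blast
        from next_node[OF this v q(3)] obtain F where F: "?results w (\<sigma>(v \<mapsto> val)) F" by blast
        have "runs G x \<delta> w (?env (\<sigma>(v \<mapsto> val)) x \<delta>) r" if "runs G x \<delta> v (?env \<sigma> x \<delta>) r" for x \<delta> r
          using that Compute unfolding env_upd eval_val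
          by (cases rule: runs.cases) (simp_all del: fun_upd_apply)
        then have "?results v \<sigma> F" using F by blast
        then show ?thesis by blast
      qed
    next
      case (Negate a w)
      then have w: "v < w" using nodes[OF v] by auto
      show ?thesis
      proof (cases "\<sigma> a")
        case None
        have "\<not> runs G x \<delta> v (?env \<sigma> x \<delta>) r" for x \<delta> r
        proof
          assume "runs G x \<delta> v (?env \<sigma> x \<delta>) r"
          then show False
            using None Negate by (cases rule: runs.cases) auto
        qed
        then show ?thesis by (intro exI[of _ "{}"]) auto
      next
        case (Some f)
        then obtain l where l: "f = hom_ext mconst s l" "total_degree l \<le> 1" "mpoly_vars l \<subseteq> {..<N + v}"
          using less.prems unfolding symbolic_env_def by blast
        interpret subst: comm_ring_hom "hom_ext mconst s"
          by (rule comm_ring_hom_hom_ext[OF comm_ring_hom_mconst])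
        have "symbolic_env p N (Suc (N + v)) s (\<sigma>(v \<mapsto> - f))"
          using step[of "- l"] l by (simp add: subst.hom_uminus total_degree_uminus mpoly_vars_uminus)
        from next_node[OF this v w] obtain F where F: "?results w (\<sigma>(v \<mapsto> - f)) F" by blast
        have "runs G x \<delta> w (?env (\<sigma>(v \<mapsto> - f)) x \<delta>) r" if "runs G x \<delta> v (?env \<sigma> x \<delta>) r" for x \<delta> r
          using that Negate Some unfolding env_upd
          by (cases rule: runs.cases) (auto simp: mpoly_eval.hom_uminus simp del: fun_upd_apply)
        then have "?results v \<sigma> F" using F by blast
        then show ?thesis by blast
      qed
    next
      case (Branch R a b w w')
      then have w: "v < w" "v < w'" using nodes[OF v] by auto
      have env: "symbolic_env p N (Suc (N + v)) s \<sigma>"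
        using less.prems by (elim symbolic_env_mono) auto
      from next_node[OF env v w(1)] obtain F where F: "?results w \<sigma> F" by blast
      from next_node[OF env v w(2)] obtain F' where F': "?results w' \<sigma> F'" by blast
      have branches: "runs G x \<delta> w (?env \<sigma> x \<delta>) r \<or> runs G x \<delta> w' (?env \<sigma> x \<delta>) r"
        if "runs G x \<delta> v (?env \<sigma> x \<delta>) r" for x \<delta> r
        using that Branch by (cases rule: runs.cases) (auto split: if_splits)
      show ?thesis
      proof (intro exI[of _ "F \<union> F'"] conjI allI impI)
        show "finite (F \<union> F')"
          using F F' by simp
        show "\<forall>f\<in>F \<union> F'. f = 0 \<or> \<not> p dvd f"
          unfolding ball_Un using F F' by (intro conjI) (elim conjE, assumption)+
        fix x \<delta> r assume "runs G x \<delta> v (?env \<sigma> x \<delta>) r"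
        from branches[OF this] show "r \<in> ?E x \<delta> ` (F \<union> F')"
          unfolding image_Un
        proof
          assume "runs G x \<delta> w (?env \<sigma> x \<delta>) r"
          then have "r \<in> ?E x \<delta> ` F" by (rule F[THEN conjunct2, THEN conjunct2, rule_format])
          then show "r \<in> ?E x \<delta> ` F \<union> ?E x \<delta> ` F'" ..
        next
          assume "runs G x \<delta> w' (?env \<sigma> x \<delta>) r"
          then have "r \<in> ?E x \<delta> ` F'" by (rule F'[THEN conjunct2, THEN conjunct2, rule_format])
          then show "r \<in> ?E x \<delta> ` F \<union> ?E x \<delta> ` F'" ..
        qed
      qed
    next
      case (Output a)
      show ?thesis
      proof (cases "\<sigma> a")
        case None
        have "\<not> runs G x \<delta> v (?env \<sigma> x \<delta>) r" for x \<delta> r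
        proof
          assume "runs G x \<delta> v (?env \<sigma> x \<delta>) r"
          then show False
            using None Output by (cases rule: runs.cases) auto
        qed
        then show ?thesis by (intro exI[of _ "{}"]) auto
      next
        case (Some f)
        then obtain l where l: "f = hom_ext mconst s l" "total_degree l \<le> 1"
          using less.prems unfolding symbolic_env_def by blast
        have "f = 0 \<or> \<not> p dvd f"
          using small[of l] l p(3) by (auto simp: hom_ext_zero[OF comm_ring_hom_mconst])
        moreover have "r = ?E x \<delta> f" if "runs G x \<delta> v (?env \<sigma> x \<delta>) r" for x \<delta> r
          using that Output Some by (cases rule: runs.cases) auto
        ultimately have "?results v \<sigma> {f}" by auto
        then show ?thesis by blast
      qed
    qed
  qed
qed

section \<open>Impossibility of accurate evaluation\<close>

text \<open>
  The polynomial \<open>g\<close> collects all nonzero symbolic results, so that one application of the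
  Nullstellensatz avoids their zeros simultaneously. The coordinates from \<open>N\<close> on of the point that
  it produces are the rounding errors. They are scaled down first; this keeps \<open>q\<close> equal to 0, since \<open>q\<close>
  involves the inputs only.
\<close>
lemma not_accurately_evaluable:
  assumes p: "p \<noteq> 0" "mpoly_vars p \<subseteq> {..<N}"
    and q: "irreducible q" "q dvd p" "total_degree q > 1"
    and B: "\<And>b. b \<in> B \<Longrightarrow> total_degree b < total_degree q"
  shows "\<not> accurately_evaluable B C N p"
proof
  assume "accurately_evaluable B C N p"
  then obtain G where alg: "is_algorithm B C N G" and acc: "accurate_on (carrier_vec N) p G"
    unfolding accurately_evaluable_def algorithm_for_def by blast
  have vars_q: "mpoly_vars q \<subseteq> {..<N}" using mpoly_vars_dvd[OF q(2)] p by blast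
  have prime: "prime_elem q" by (rule irreducible_imp_prime_elem_mpoly[OF q(1)])

  have nodes: "admissible_node B C N (G ! v) \<and> (\<forall>w\<in>successors (G ! v). v < w \<and> w < length G)"
    if "v < length G" for v
    using alg that unfolding is_algorithm_def by blast
  have "symbolic_env q N (N + 0) mvar Map.empty"
    by (simp add: symbolic_env_def generic_subst_mvar)
  from symbolic_results[OF nodes q(1) vars_q q(3) B this] obtain F where F: "finite F"
    "\<And>f. f \<in> F \<Longrightarrow> f = 0 \<or> \<not> q dvd f"
    "\<And>x \<delta> r. runs G x \<delta> 0 Map.empty r \<Longrightarrow> r \<in> mpoly_eval (run_point N x \<delta>) ` F"
    by auto
  have result: "p_comp G x \<delta> \<in> mpoly_eval (run_point N x \<delta>) ` F" if "x \<in> carrier_vec N" for x \<delta>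
  proof -
    from alg that obtain r where r: "runs G x \<delta> 0 Map.empty r" unfolding is_algorithm_def by blast
    then have "p_comp G x \<delta> = r" unfolding p_comp_def by (auto intro: runs_unique)
    then show ?thesis using F(3)[OF r] by simp
  qed

  define g where "g = \<Prod>(F - {0})"
  have "\<not> q dvd \<Prod>A" if "finite A" "A \<subseteq> F - {0}" for A
    using that
  proof (induction A rule: finite_induct)
    case (insert f A)
    then have "\<not> q dvd f" using F(2)[of f] by blast
    with insert prime show ?case by (auto dest: prime_elem_dvd_multD)
  qed (use q in \<open>auto simp: irreducible_def\<close>)
  then have "\<not> q dvd g" using F(1) by (simp add: g_def)
  then obtain z where z: "mpoly_eval z q = 0" "mpoly_eval z g \<noteq> 0"
    using hypersurface_nullstellensatz[OF q(1)] by blast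

  have "\<exists>\<epsilon>::real. 0 < \<epsilon> \<and> \<epsilon> < 1 \<and> (\<forall>x\<in>carrier_vec N. \<forall>\<delta>. (\<forall>i<length G. cmod (\<delta> i) \<le> \<epsilon>) \<longrightarrow>
        cmod (p_comp G x \<delta> - mpoly_eval (($) x) p) \<le> 1 / 2 * cmod (mpoly_eval (($) x) p))"
    using acc unfolding accurate_on_def by (elim allE[of _ "1 / 2"]) simp
  then obtain \<epsilon> :: real where \<epsilon>: "\<epsilon> > 0" and accurate:
    "\<And>x \<delta>. x \<in> carrier_vec N \<Longrightarrow> (\<And>i. i < length G \<Longrightarrow> cmod (\<delta> i) \<le> \<epsilon>) \<Longrightarrow>
       cmod (p_comp G x \<delta> - mpoly_eval (($) x) p) \<le> 1 / 2 * cmod (mpoly_eval (($) x) p)"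
    by blast

  \<comment> \<open>Shrink the rounding errors along the line from \<open>z0\<close>, where they are 0, towards \<open>z\<close>.\<close>
  define z0 where "z0 i = (if i < N then z i else 0)" for i
  define d where "d i = (if i < N then 0 else z i)" for i
  have "(\<lambda>i. z0 i + d i) = z" by (auto simp: z0_def d_def)
  then have "eventually (\<lambda>t. mpoly_eval (\<lambda>i. z0 i + t * d i) g \<noteq> 0) (at 0)"
    using z(2) by (intro eventually_mpoly_line_nonzero) simp
  moreover have "eventually (\<lambda>t. \<forall>j\<in>{..<length G}. cmod (t * z (N + j)) < \<epsilon>) (at 0)"
  proof (intro eventually_ball_finite ballI)
    fix j
    have "((\<lambda>t. cmod (t * z (N + j))) \<longlongrightarrow> cmod (0 * z (N + j))) (at 0)"
      by (intro tendsto_intros)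
    then show "eventually (\<lambda>t. cmod (t * z (N + j)) < \<epsilon>) (at 0)"
      using \<epsilon> by (intro order_tendstoD(2)) auto
  qed simp
  ultimately have "eventually (\<lambda>t. mpoly_eval (\<lambda>i. z0 i + t * d i) g \<noteq> 0 \<and>
      (\<forall>j\<in>{..<length G}. cmod (t * z (N + j)) < \<epsilon>)) (at (0::complex))"
    by (rule eventually_conj)
  from eventually_happens'[OF at_neq_bot this] obtain t where t:
      "mpoly_eval (\<lambda>i. z0 i + t * d i) g \<noteq> 0"
      "\<And>j. j < length G \<Longrightarrow> cmod (t * z (N + j)) < \<epsilon>"
    by auto
  define y where "y i = z0 i + t * d i" for i
  define \<delta> where "\<delta> j = y (N + j)" for j
  have \<delta>: "cmod (\<delta> j) \<le> \<epsilon>" if "j < length G" for j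
    using t(2)[OF that] by (simp add: \<delta>_def y_def z0_def d_def)
  have "mpoly_eval y q = mpoly_eval z q"
    using vars_q by (intro mpoly_eval_cong) (auto simp: y_def z0_def d_def)
  then have py: "mpoly_eval y p = 0"
    using z(1) q(2) by (auto elim!: dvdE simp: mpoly_eval.hom_mult)
  have "y = (\<lambda>i. z0 i + t * d i)" by (simp add: fun_eq_iff y_def)
  then have gy: "mpoly_eval y g \<noteq> 0" using t(1) by simp
  have fy: "mpoly_eval y f \<noteq> 0" if "f \<in> F" "f \<noteq> 0" for f
  proof -
    have "f dvd g" unfolding g_def using that F(1) by (intro dvd_prodI) auto
    then show ?thesis
      using gy by (auto elim!: dvdE simp: mpoly_eval.hom_mult)
  qed

  obtain a where a: "mpoly_eval a p \<noteq> 0" using mpoly_nonzero_point[OF p(1)] by blast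
  \<comment> \<open>Move the inputs, with fixed rounding errors, from the zero \<open>y\<close> of \<open>p\<close> towards the nonzero \<open>a\<close>.\<close>
  define e where "e i = (if i < N then a i - y i else 0)" for i
  define x where "x t i = y i + t * e i" for t i
  have "mpoly_eval (\<lambda>i. y i + e i) p = mpoly_eval a p"
    using p(2) by (intro mpoly_eval_cong) (auto simp: e_def)
  then have p_nonzero: "eventually (\<lambda>t. mpoly_eval (x t) p \<noteq> 0) (at 0)"
    unfolding x_def using a by (intro eventually_mpoly_line_nonzero) simp
  have lim: "((\<lambda>t. mpoly_eval (x t) f) \<longlongrightarrow> mpoly_eval y f) (at 0)" for f
    unfolding x_def by (rule tendsto_mpoly_line)
  have "eventually (\<lambda>t. \<forall>f\<in>F. 1 / 2 * cmod (mpoly_eval (x t) p) <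
      cmod (mpoly_eval (x t) f - mpoly_eval (x t) p)) (at 0)"
  proof (intro eventually_ball_finite ballI F(1))
    fix f assume f: "f \<in> F"
    show "eventually (\<lambda>t. 1 / 2 * cmod (mpoly_eval (x t) p) <
      cmod (mpoly_eval (x t) f - mpoly_eval (x t) p)) (at 0)"
    proof (cases "f = 0")
      case True
      then show ?thesis using p_nonzero by (auto elim!: eventually_mono)
    next
      case False
      have "((\<lambda>t. cmod (mpoly_eval (x t) f - mpoly_eval (x t) p) - 1 / 2 * cmod (mpoly_eval (x t) p))
          \<longlongrightarrow> cmod (mpoly_eval y f - mpoly_eval y p) - 1 / 2 * cmod (mpoly_eval y p)) (at 0)"
        by (intro tendsto_intros lim)
      then have "eventually (\<lambda>t. 0 < cmod (mpoly_eval (x t) f - mpoly_eval (x t) p) -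
          1 / 2 * cmod (mpoly_eval (x t) p)) (at 0)"
        using fy[OF f False] py by (intro order_tendstoD(1)) auto
      then show ?thesis by (simp add: algebra_simps)
    qed
  qed
  from eventually_happens'[OF at_neq_bot this] obtain t' where t':
      "\<And>f. f \<in> F \<Longrightarrow> 1 / 2 * cmod (mpoly_eval (x t') p) <
        cmod (mpoly_eval (x t') f - mpoly_eval (x t') p)"
    by blast
  define X where "X = vec N (x t')"
  have X: "X \<in> carrier_vec N" by (simp add: X_def)
  have point: "run_point N X \<delta> = x t'"
    by (auto simp: run_point_def X_def \<delta>_def x_def e_def)
  have "mpoly_eval (($) X) p = mpoly_eval (x t') p"
    using p(2) by (intro mpoly_eval_cong) (auto simp: X_def)
  with accurate[OF X \<delta>] have
    "cmod (p_comp G X \<delta> - mpoly_eval (x t') p) \<le> 1 / 2 * cmod (mpoly_eval (x t') p)" by simp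
  moreover from result[OF X, of \<delta>] obtain f where "f \<in> F" "p_comp G X \<delta> = mpoly_eval (x t') f"
    unfolding point by blast
  ultimately show False using t' by fastforce
qed

theorem theorem3p41:
  fixes N :: "nat \<Rightarrow> nat"
    and M :: "nat \<Rightarrow> complex vec \<Rightarrow> complex mat"
    and p phat :: "nat \<Rightarrow> mpoly"
    and B :: "mpoly set"
    and C :: "(complex \<Rightarrow> complex \<Rightarrow> bool) set"
  assumes M: "\<And>n x. n \<ge> 1 \<Longrightarrow> x \<in> carrier_vec (N n) \<Longrightarrow> M n x \<in> carrier_mat n n"
    and p_vars: "\<And>n. n \<ge> 1 \<Longrightarrow> mpoly_vars (p n) \<subseteq> {..<N n}"
    and p_det: "\<And>n x. n \<ge> 1 \<Longrightarrow> x \<in> carrier_vec (N n) \<Longrightarrow>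
                  mpoly_eval (($) x) (p n) = det (M n x)"
    and p_nonzero: "\<And>n. n \<ge> 1 \<Longrightarrow> p n \<noteq> 0"
    and factor: "\<And>n. n \<ge> 1 \<Longrightarrow> irreducible (phat n) \<and> phat n dvd p n"
    and degree: "filterlim (\<lambda>n. total_degree (phat n)) at_top sequentially"
    and "black_boxes B" and "countable B" and "bounded_degree B"
  shows "\<forall>\<^sub>F n in sequentially. \<not> accurately_evaluable B C (N n) (p n)"
proof -
  obtain D where D: "\<And>q. q \<in> B \<Longrightarrow> total_degree q \<le> D"
    using \<open>bounded_degree B\<close> unfolding bounded_degree_def by blast
  have "\<forall>\<^sub>F n in sequentially. total_degree (phat n) \<ge> D + 2"
    using degree unfolding filterlim_at_top by blast
  then show ?thesis
    using eventually_ge_at_top[of 1]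
  proof eventually_elim
    case (elim n)
    have "total_degree b < total_degree (phat n)" if "b \<in> B" for b
      using D[OF that] elim(1) by simp
    with p_nonzero[of n] p_vars[of n] factor[of n] elim show ?case
      by (intro not_accurately_evaluable[where q = "phat n"]) auto
  qed
qed

end
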